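(* Let $\xi_0,\xi_1,\ldots$ be non-degenerate i.i.d. complex-valued random variables such that $\mathbb{E}\log(1+|\xi_0|)<\infty$. Let $w_0,w_1,\ldots$ be a complex sequence such that $\lim_{k\to\infty}\frac1k\log|w_k|=w$ for some constant $w\in\mathbb{R}$, and let $W_n(z)=\sum_{k=0}^n\xi_kw_kz^k$. Then, as $n\to\infty$, the sequence of random measures $\frac1n\mu_{W_n}$ converges in probability to the uniform probability distribution on the circle of radius $e^{-w}$ centered at the origin.
   Context: A random variable is non-degenerate if it is not almost surely equal to a constant. For a polynomial $G\not\equiv0$, $\mu_G=\sum_{z:G(z)=0}n_G(z)\,\delta_z$ is the measure on $\mathbb{C}$ counting zeros with multiplicity $n_G(z)$. On the event $W_n\equiv0$ (whose probability tends to $0$) the measure may be given any value, e.g. $0$. Random measures $\mu_n$ on $\mathbb{C}$ converge in probability to $\mu$ if, for every continuous compactly supported $\varphi:\mathbb{C}\to\mathbb{R}$, $\int\varphi\,d\mu_n\to\int\varphi\,d\mu$ in probability. *)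

theory Defs
  imports "HOL-Probability.Probability" "HOL-Computational_Algebra.Polynomial"
begin

text \<open>Logarithm on \<open>[0, \<infinity>)\<close> with \<open>log 0 = -\<infinity>\<close>; the library's real \<open>ln\<close> has \<open>ln 0 = 0\<close>, so a limit
  condition on \<open>ln (norm (w k))\<close> would not notice vanishing coefficients.\<close>

definition ln_ext :: "real \<Rightarrow> ereal" where
  "ln_ext x = (if x = 0 then -\<infinity> else ereal (ln x))"

definition nondegenerate :: "'a measure \<Rightarrow> ('a \<Rightarrow> 'b) \<Rightarrow> bool" where
  "nondegenerate M X \<longleftrightarrow> \<not> (\<exists>c. AE x in M. X x = c)"

definition iid :: "'a measure \<Rightarrow> (nat \<Rightarrow> 'a \<Rightarrow> complex) \<Rightarrow> bool" where
  "iid M X \<longleftrightarrow> prob_space.indep_vars M (\<lambda>_. borel) X UNIV \<and>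
     (\<forall>k. distr M borel (X k) = distr M borel (X 0))"

definition weighted_poly :: "(nat \<Rightarrow> 'a \<Rightarrow> complex) \<Rightarrow> (nat \<Rightarrow> complex) \<Rightarrow> nat \<Rightarrow> 'a \<Rightarrow> complex poly" where
  "weighted_poly \<xi> w n \<omega> = (\<Sum>k\<le>n. monom (\<xi> k \<omega> * w k) k)"

lemma poly_weighted_poly: "poly (weighted_poly \<xi> w n \<omega>) z = (\<Sum>k=0..n. \<xi> k \<omega> * w k * z ^ k)"
  by (simp add: weighted_poly_def poly_sum poly_monom atMost_atLeast0)

text \<open>Zeros counted with multiplicity, pushed forward along the inclusion of the finite zero set
  so that the \<open>\<sigma>\<close>-algebra is the Borel one. The zero polynomial gets the zero measure.\<close>

definition zero_measure :: "complex poly \<Rightarrow> complex measure" where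
  "zero_measure p =
     (if p = 0 then null_measure borel
      else distr (point_measure {z. poly p z = 0} (\<lambda>z. of_nat (order z p))) borel (\<lambda>z. z))"

lemma sets_zero_measure [simp]: "sets (zero_measure p) = sets borel"
  by (simp add: zero_measure_def)

lemma emeasure_zero_measure:
  assumes "p \<noteq> 0" "A \<in> sets borel"
  shows "emeasure (zero_measure p) A =
    (\<Sum>z | poly p z = 0. of_nat (order z p) * indicator A z)"
proof -
  have fin: "finite {z. poly p z = 0}"
    using assms(1) by (rule poly_roots_finite)
  have "emeasure (zero_measure p) A = (\<Sum>z\<in>A \<inter> {z. poly p z = 0}. of_nat (order z p))"
    using assms fin
    by (simp add: zero_measure_def emeasure_distr measurable_def sets_point_measure space_point_measure
        emeasure_point_measure_finite)
  also have "\<dots> = (\<Sum>z | poly p z = 0. of_nat (order z p) * indicator A z)"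
    using fin by (intro sum.mono_neutral_cong_left) (auto simp: indicator_def)
  finally show ?thesis .
qed

definition uniform_circle :: "real \<Rightarrow> complex measure" where
  "uniform_circle r =
     distr (uniform_measure lborel {0..2 * pi}) borel (\<lambda>t. complex_of_real r * cis t)"

text \<open>The next definition includes measurability, i.e. that the objects involved are random
  variables: \<open>measure\<close> is \<open>0\<close> outside the \<open>\<sigma>\<close>-algebra, so the limit alone would be vacuous for
  non-measurable functions.\<close>

definition converges_in_probability ::
    "'a measure \<Rightarrow> (nat \<Rightarrow> 'a \<Rightarrow> real) \<Rightarrow> ('a \<Rightarrow> real) \<Rightarrow> bool" where
  "converges_in_probability M X Y \<longleftrightarrow>
     (\<forall>n. X n \<in> borel_measurable M) \<and> Y \<in> borel_measurable M \<and>
     (\<forall>\<epsilon>>0. (\<lambda>n. measure M {\<omega> \<in> space M. \<bar>X n \<omega> - Y \<omega>\<bar> > \<epsilon>}) \<longlonglongrightarrow> 0)"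

definition measures_converge_in_probability ::
    "'a measure \<Rightarrow> (nat \<Rightarrow> 'a \<Rightarrow> complex measure) \<Rightarrow> ('a \<Rightarrow> complex measure) \<Rightarrow> bool" where
  "measures_converge_in_probability M \<mu> \<nu> \<longleftrightarrow>
     (\<forall>\<phi> :: complex \<Rightarrow> real. continuous_on UNIV \<phi> \<longrightarrow> compact (closure {z. \<phi> z \<noteq> 0}) \<longrightarrow>
        converges_in_probability M
          (\<lambda>n \<omega>. integral\<^sup>L (\<mu> n \<omega>) \<phi>) (\<lambda>\<omega>. integral\<^sup>L (\<nu> \<omega>) \<phi>))"

end

(* The argument is deterministic up to elementary estimates. If a polynomial p of degree at most n
   satisfies |p| <= exp (eps n) on |z| = r, and its lowest nonzero coefficient c_j and its leading
   coefficient c_d satisfy |c_j| r^j, |c_d| r^d >= exp (- eps n) with j and n - d at most eps n, then its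
   roots are close to uniform on |z| = r. After rescaling to r = 1, Jensen's inequality bounds the sum of
   the |ln |y|| over the nonzero roots y by O(eps n). By Schur's inequality the polynomial with roots y/|y|
   is bounded by exp (O(eps n)) on the unit circle, and Borel-Caratheodory applied to its logarithm bounds
   the power sums of the y/|y|, so all angular moments vanish in the limit (Erdos-Turan).
   For W_n these hypotheses hold with probability tending to 1: the upper bound because
   n P(ln (1 + |xi_0|) > eps n) tends to 0, the lower bounds because a nonzero xi_k occurs within a bounded
   distance from either end of the index range with probability arbitrarily close to 1. *)

theory Submission
  imports
    Defs
    "HOL-Complex_Analysis.Conformal_Mappings"
    "HOL-Computational_Algebra.Fundamental_Theorem_Algebra"
    "HOL-Real_Asymp.Real_Asymp"
begin


section \<open>Power sums of the projected roots\<close>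

text \<open>Everything is normalised by the geometric mean of the two extreme nonzero coefficients.
  Schur's and Jensen's inequalities both divide by this quantity, so the random polynomial needs
  lower bounds for two coefficients and never for its modulus at a point of the plane. The obstacle
  is that these coefficients sit at random places: \<open>\<xi> k\<close> may vanish with positive
  probability, and finitely many weights may be zero. Hence the deterministic estimate is phrased
  with \<open>order 0 p\<close> and \<open>degree p\<close>, and a lower bound is required at every
  nonzero coefficient near either end. No moment controls how small a nonzero \<open>\<xi> k\<close>
  may be; the bound is available since a fixed number of indices is involved while n grows. Moments
  of order k are reduced to the first one by passing to k-th powers of the roots, so only a first
  Taylor coefficient is ever estimated. Convergence in probability also demands measurable root
  sums; instead of choosing roots measurably, occupied cells of a grid are counted.\<close>

lemma norm_prod_mset: "norm (\<Prod>x\<in>#A. f x) = (\<Prod>x\<in>#A. norm (f x))"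
  for f :: "'a \<Rightarrow> 'b :: {comm_monoid_mult, real_normed_div_algebra}"
  by (induction A) (auto simp: norm_mult)

lemma norm_sum_mset_le: "norm (\<Sum>x\<in>#A. f x) \<le> (\<Sum>x\<in>#A. norm (f x))"
  for f :: "'a \<Rightarrow> 'b :: real_normed_vector"
  by (induction A) (auto intro: norm_triangle_le)

lemma prod_mset_nonneg:
  fixes f :: "'a \<Rightarrow> real"
  assumes "\<And>x. x \<in># A \<Longrightarrow> 0 \<le> f x"
  shows "0 \<le> (\<Prod>x\<in>#A. f x)"
  using assms by (induction A) auto

lemma prod_mset_mono_real:
  fixes f g :: "'a \<Rightarrow> real"
  assumes "\<And>x. x \<in># A \<Longrightarrow> 0 \<le> f x" "\<And>x. x \<in># A \<Longrightarrow> f x \<le> g x"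
  shows "(\<Prod>x\<in>#A. f x) \<le> (\<Prod>x\<in>#A. g x)"
  using assms by (induction A) (auto intro!: mult_mono prod_mset_nonneg intro: order_trans)

lemma holomorphic_on_prod_mset:
  assumes "\<And>x. x \<in># A \<Longrightarrow> f x holomorphic_on S"
  shows "(\<lambda>z. \<Prod>x\<in>#A. f x z) holomorphic_on S"
  using assms by (induction A) (auto intro!: holomorphic_intros)

lemma unit_circle_max_modulus:
  assumes "f holomorphic_on UNIV" "\<And>u. norm u = 1 \<Longrightarrow> norm (f u) \<le> B" "norm z < 1"
  shows "norm (f z) \<le> B"
proof (rule maximum_modulus_frontier[of f "ball 0 1"])
  show "f holomorphic_on interior (ball 0 1)"
    using assms(1) holomorphic_on_subset by blast
  show "continuous_on (closure (ball 0 1)) f"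
    using assms(1) holomorphic_on_imp_continuous_on continuous_on_subset by blast
qed (use assms in auto)

text \<open>Schur's inequality: radially projecting the roots to the unit circle does not increase the modulus of
  the polynomial there, after normalisation by the geometric mean of the end coefficients.\<close>

lemma norm_diff_sgn_mult_sqrt_le:
  fixes u x :: complex
  assumes u: "norm u = 1" and x: "x \<noteq> 0"
  shows "norm (u - sgn x) * sqrt (norm x) \<le> norm (u - x)"
proof -
  define t where "t = norm x"
  define s where "s = sgn x"
  have t: "t > 0" using x by (simp add: t_def)
  have s: "norm s = 1" using x by (simp add: s_def norm_sgn)
  have xs: "x = of_real t * s"
    by (simp add: t_def s_def sgn_div_norm scaleR_conv_of_real x)
  have u2: "(Re u)\<^sup>2 + (Im u)\<^sup>2 = 1" using u by (simp add: cmod_def)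
  have s2: "(Re s)\<^sup>2 + (Im s)\<^sup>2 = 1" using s by (simp add: cmod_def)
  have "(norm (u - s) * sqrt t)\<^sup>2 = ((Re u - Re s)\<^sup>2 + (Im u - Im s)\<^sup>2) * t"
    using t by (simp add: power_mult_distrib cmod_power2)
  also have "\<dots> = (2 - 2 * (Re u * Re s + Im u * Im s)) * t"
    using u2 s2 by (simp add: power2_diff algebra_simps)
  \<comment> \<open>The squares of the two sides differ by exactly this term: |u - t s|^2 = 1 + t^2
    - 2 t c and t |u - s|^2 = 2 t - 2 t c, with c the inner product of \<open>u\<close> and
    \<open>s\<close>.\<close>
  also have "\<dots> \<le> \<dots> + (1 - t)\<^sup>2" by simp
  also have "\<dots> = ((Re u)\<^sup>2 + (Im u)\<^sup>2) + t\<^sup>2 * ((Re s)\<^sup>2 + (Im s)\<^sup>2) - 2 * t * (Re u * Re s + Im u * Im s)"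
    unfolding u2 s2 by (simp add: power2_diff algebra_simps)
  also have "\<dots> = (Re u - t * Re s)\<^sup>2 + (Im u - t * Im s)\<^sup>2"
    by (simp add: power2_diff algebra_simps power_mult_distrib)
  also have "\<dots> = (norm (u - x))\<^sup>2"
    unfolding xs by (simp add: cmod_power2)
  finally show ?thesis
    unfolding s_def[symmetric] t_def[symmetric] by (rule power2_le_imp_le) simp
qed

text \<open>Each factor \<open>1 - z * x\<close> has positive real part on the disc, so principal
  logarithms exist factor by factor; adding them avoids branch questions and yields the derivative
  at 0 along with the function.\<close>

lemma ex_log_prod_mset:
  fixes A :: "complex multiset"
  assumes "\<And>x. x \<in># A \<Longrightarrow> norm x \<le> 1"
  obtains g where "g holomorphic_on ball 0 1" "g 0 = 0"
    "\<And>z. norm z < 1 \<Longrightarrow> exp (g z) = (\<Prod>x\<in>#A. 1 - z * x)"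
    "(g has_field_derivative - (\<Sum>x\<in>#A. x)) (at 0)"
proof -
  have "\<exists>g. g holomorphic_on ball 0 1 \<and> g 0 = 0 \<and>
    (\<forall>z. norm z < 1 \<longrightarrow> exp (g z) = (\<Prod>x\<in>#A. 1 - z * x)) \<and>
    (g has_field_derivative - (\<Sum>x\<in>#A. x)) (at 0)"
    using assms
  proof (induction A)
    case empty
    show ?case by (rule exI[of _ "\<lambda>_. 0"]) auto
  next
    case (add x A)
    then obtain g where g: "g holomorphic_on ball 0 1" "g 0 = 0"
      "\<And>z. norm z < 1 \<Longrightarrow> exp (g z) = (\<Prod>x\<in>#A. 1 - z * x)"
      "(g has_field_derivative - (\<Sum>x\<in>#A. x)) (at 0)"
      by auto
    have re: "Re (1 - z * x) > 0" if "norm z < 1" for z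
    proof -
      have "norm (z * x) \<le> norm z * 1"
        unfolding norm_mult using add.prems by (intro mult_left_mono) auto
      then have "norm (z * x) < 1" using that by simp
      then have "\<bar>Re (z * x)\<bar> < 1"
        using abs_Re_le_cmod[of "z * x"] by linarith
      then show ?thesis by simp
    qed
    have nonneg: "1 - z * x \<notin> \<real>\<^sub>\<le>\<^sub>0" "1 - z * x \<noteq> 0" if "norm z < 1" for z
      using re[OF that] by (auto simp: complex_nonpos_Reals_iff dest: arg_cong[of _ _ Re])
    show ?case
    proof (rule exI[of _ "\<lambda>z. Ln (1 - z * x) + g z"], intro conjI allI impI)
      show "(\<lambda>z. Ln (1 - z * x) + g z) holomorphic_on ball 0 1"
        using g(1) nonneg by (auto intro!: holomorphic_intros)
      show "exp (Ln (1 - z * x) + g z) = (\<Prod>x\<in>#add_mset x A. 1 - z * x)" if "norm z < 1" for z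
        using g(3)[OF that] nonneg[OF that] by (simp add: exp_add)
      show "((\<lambda>z. Ln (1 - z * x) + g z) has_field_derivative - (\<Sum>x\<in>#add_mset x A. x)) (at 0)"
        by (auto intro!: derivative_eq_intros g(4))
    qed (use g in auto)
  qed
  then show ?thesis using that by blast
qed

text \<open>Borel--Caratheodory for the first Taylor coefficient: if \<open>Re g \<le> a\<close> and \<open>g 0 = 0\<close>, then
  \<open>g / (2 a - g)\<close> maps the disc to itself.\<close>

lemma deriv_bound_Re_le:
  fixes g :: "complex \<Rightarrow> complex"
  assumes hol: "g holomorphic_on ball 0 1" and g0: "g 0 = 0"
    and re: "\<And>z. norm z < 1 \<Longrightarrow> Re (g z) \<le> a"
    and d: "(g has_field_derivative D) (at 0)"
  shows "norm D \<le> 2 * a"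
proof -
  have a0: "a \<ge> 0" using re[of 0] g0 by simp
  \<comment> \<open>The margin \<open>b > a\<close> keeps the denominator of \<open>h\<close>
    nonzero and makes \<open>b\<close> positive even when \<open>a = 0\<close>; letting
    \<open>b\<close> tend to \<open>a\<close> gives the claim.\<close>
  have *: "norm D / 2 \<le> b" if "b > a" for b
  proof -
    have b0: "b > 0" using a0 that by simp
    define h where "h = (\<lambda>z. g z / (2 * of_real b - g z))"
    have nz: "2 * of_real b - g z \<noteq> 0" if "norm z < 1" for z
    proof
      assume "2 * of_real b - g z = 0"
      then have "Re (g z) = 2 * b" by (simp add: complex_eq_iff)
      then show False using re[OF that] \<open>b > a\<close> b0 by simp
    qed
    have h: "h holomorphic_on ball 0 1"
      unfolding h_def using hol nz by (auto intro!: holomorphic_intros)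
    have h0: "h 0 = 0" by (simp add: h_def g0)
    have lt: "norm (h z) < 1" if "norm z < 1" for z
    proof -
      \<comment> \<open>This suffices because |2 b - g|^2 - |g|^2 = 4 b (b - Re g).\<close>
      have "b * Re (g z) < b * b" using re[OF that] \<open>b > a\<close> b0 by simp
      then have "(norm (g z))\<^sup>2 < (norm (2 * of_real b - g z))\<^sup>2"
        by (simp add: cmod_power2 power2_diff algebra_simps) (simp add: power2_eq_square)
      then have "norm (g z) < norm (2 * of_real b - g z)"
        using power_less_imp_less_base norm_ge_zero by blast
      then show ?thesis unfolding h_def norm_divide using nz[OF that] by (simp add: divide_simps)
    qed
    have "(h has_field_derivative (D / (2 * of_real b))) (at 0)"
      unfolding h_def using b0 g0
      by (auto intro!: derivative_eq_intros d simp: field_simps)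
    then have "deriv h 0 = D / (2 * of_real b)" by (rule DERIV_imp_deriv)
    moreover have "norm (deriv h 0) \<le> 1"
      using Schwarz_Lemma(2)[of h 0, OF h h0] lt by simp
    ultimately have "norm (D / (2 * of_real b)) \<le> 1" by simp
    then show ?thesis using b0 by (simp add: norm_divide norm_mult divide_le_eq mult.commute)
  qed
  have "norm D / 2 \<le> a"
    by (rule dense_ge) (use * in auto)
  then show ?thesis by simp
qed

text \<open>The product of the \<open>1 - z * cnj x\<close> has value 1 at the origin and, on the
  unit circle, the modulus of the product of the \<open>u - x\<close>. The maximum principle thus
  gives \<open>1 \<le> H\<close> and bounds the real part of its logarithm by \<open>ln H\<close>;
  the first Taylor coefficient of that logarithm is minus the conjugate of the sum.\<close>

lemma norm_sum_unit_roots_le: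
  fixes A :: "complex multiset"
  assumes unit: "\<And>x. x \<in># A \<Longrightarrow> norm x = 1"
    and H: "\<And>u. norm u = 1 \<Longrightarrow> (\<Prod>x\<in>#A. norm (u - x)) \<le> H"
  shows "norm (\<Sum>x\<in>#A. x) \<le> 2 * ln H" "1 \<le> H"
proof -
  define f where "f = (\<lambda>z. \<Prod>x\<in>#image_mset cnj A. 1 - z * x)"
  have fB: "norm (f z) \<le> H" if "norm z < 1" for z
  proof (rule unit_circle_max_modulus[OF _ _ that])
    show "f holomorphic_on UNIV"
      unfolding f_def by (intro holomorphic_on_prod_mset) (auto intro!: holomorphic_intros)
    fix u :: complex assume u: "norm u = 1"
    have "norm (1 - u * cnj x) = norm (u - x)" if "x \<in># A" for x
    proof -
      have "x * cnj x = 1" using unit[OF that] by (simp add: complex_norm_square[symmetric])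
      then have "x * (1 - u * cnj x) = x - u" by (simp add: algebra_simps)
      then have "norm x * norm (1 - u * cnj x) = norm (x - u)" by (metis norm_mult)
      then show ?thesis using unit[OF that] by (simp add: norm_minus_commute)
    qed
    then have "norm (f u) = (\<Prod>x\<in>#A. norm (u - x))"
      unfolding f_def norm_prod_mset by (simp add: image_mset.compositionality o_def cong: image_mset_cong)
    then show "norm (f u) \<le> H" using H[OF u] by simp
  qed
  have f0: "f 0 = 1" by (simp add: f_def)
  show H1: "1 \<le> H" using fB[of 0] f0 by simp
  obtain g where g: "g holomorphic_on ball 0 1" "g 0 = 0"
    "\<And>z. norm z < 1 \<Longrightarrow> exp (g z) = f z"
    "(g has_field_derivative - (\<Sum>x\<in>#image_mset cnj A. x)) (at 0)"
    unfolding f_def by (rule ex_log_prod_mset[of "image_mset cnj A"]) (use unit in auto)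
  have "norm (- (\<Sum>x\<in>#image_mset cnj A. x)) \<le> 2 * ln H"
  proof (rule deriv_bound_Re_le[OF g(1,2) _ g(4)])
    fix z :: complex assume z: "norm z < 1"
    have "exp (Re (g z)) \<le> H"
      using fB[OF z] g(3)[OF z] norm_exp_eq_Re by metis
    then show "Re (g z) \<le> ln H" using H1 by (simp add: ln_ge_iff)
  qed
  moreover have "(\<Sum>x\<in>#image_mset cnj A. x) = cnj (\<Sum>x\<in>#A. x)"
    by (induction A) auto
  ultimately show "norm (\<Sum>x\<in>#A. x) \<le> 2 * ln H" by simp
qed

text \<open>\<open>X^k - 1\<close> shares no root with its derivative, so it splits into distinct
  linear factors over the roots of unity; homogenising gives the two-variable form. It transfers a
  bound on the product over the roots to the product over their k-th powers.\<close>

lemma prod_roots_of_unity: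
  fixes v x :: complex
  assumes k: "k > 0"
  shows "v ^ k - x ^ k = (\<Prod>\<zeta> | \<zeta> ^ k = 1. v - \<zeta> * x)"
proof -
  define p :: "complex poly" where "p = monom 1 k - 1"
  have degm: "degree (monom (1::complex) k) = k" by (simp add: degree_monom_eq)
  have deg: "degree p = k"
    unfolding p_def using degree_diff_less[of 1 k] k degm
    by (metis degree_1 degree_add_eq_left degree_minus diff_conv_add_uminus)
  have lc: "lead_coeff p = 1" unfolding deg unfolding p_def using k by simp
  have pol: "poly p z = z ^ k - 1" for z by (simp add: p_def poly_monom)
  have "pderiv p = monom (of_nat k) (k - 1)" by (simp add: p_def pderiv_diff pderiv_monom)
  then have "rsquarefree p"
    unfolding rsquarefree_roots pol using k by (auto simp: poly_monom power_0_left)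
  then have "smult (lead_coeff p) (\<Prod>z|poly p z = 0. [:-z, 1:]) = p"
    by (rule complex_poly_decompose_rsquarefree)
  then have dec: "p = (\<Prod>z|z ^ k = 1. [:-z, 1:])" using lc pol by simp
  have *: "z ^ k - 1 = (\<Prod>\<zeta> | \<zeta> ^ k = 1. z - \<zeta>)" for z :: complex
    using arg_cong[OF dec, of "\<lambda>q. poly q z"] by (simp add: pol poly_prod)
  have card: "card {\<zeta>::complex. \<zeta> ^ k = 1} = k"
    using card_complex_roots_unity[of k] k by simp
  show ?thesis
  proof (cases "x = 0")
    case True
    then show ?thesis using k card by simp
  next
    case False
    have "v ^ k - x ^ k = x ^ k * ((v / x) ^ k - 1)" using False by (simp add: field_simps power_divide)
    also have "\<dots> = (\<Prod>\<zeta>\<in>{\<zeta>::complex. \<zeta> ^ k = 1}. x) * (\<Prod>\<zeta> | \<zeta> ^ k = 1. v / x - \<zeta>)" using * card by simp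
    also have "\<dots> = (\<Prod>\<zeta> | \<zeta> ^ k = 1. v - \<zeta> * x)"
      unfolding prod.distrib[symmetric] using False by (intro prod.cong) (auto simp: field_simps)
    finally show ?thesis .
  qed
qed

text \<open>The k-th powers of the roots again lie on the unit circle. Their product at
  \<open>u = v ^ k\<close> splits into \<open>k\<close> products of the original kind, at the points
  \<open>v / \<zeta>\<close>, so it is at most \<open>H ^ k\<close>; the factor \<open>k\<close> is
  that of \<open>ln (H ^ k)\<close>.\<close>

lemma power_sum_bound:
  fixes A :: "complex multiset"
  assumes unit: "\<And>x. x \<in># A \<Longrightarrow> norm x = 1"
    and H: "\<And>u. norm u = 1 \<Longrightarrow> (\<Prod>x\<in>#A. norm (u - x)) \<le> H"
    and k: "k > 0"
  shows "norm (\<Sum>x\<in>#A. x ^ k) \<le> 2 * real k * ln H"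
proof -
  have H1: "1 \<le> H" using norm_sum_unit_roots_le(2)[OF unit H] by blast
  have card: "card {\<zeta>::complex. \<zeta> ^ k = 1} = k"
    using card_complex_roots_unity[of k] k by simp
  have "(\<Prod>x\<in>#image_mset (\<lambda>x. x ^ k) A. norm (u - x)) \<le> H ^ k" if u: "norm u = 1" for u
  proof -
    define v where "v = exp (Ln u / of_nat k)"
    have "exp (of_nat k * (Ln u / of_nat k)) = u" using k u by (simp, subst exp_Ln) auto
    then have v: "u = v ^ k" unfolding v_def exp_of_nat_mult[symmetric] by simp
    then have v1: "norm v = 1" using u k power_eq_1_iff[of "of_real (norm v)" k]
      by (simp add: norm_power flip: of_real_power)
    have "(\<Prod>x\<in>#image_mset (\<lambda>x. x ^ k) A. norm (u - x)) = (\<Prod>x\<in>#A. norm (v ^ k - x ^ k))"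
      by (simp add: image_mset.compositionality o_def v)
    also have "\<dots> = (\<Prod>x\<in>#A. \<Prod>\<zeta> | \<zeta> ^ k = 1. norm (v - \<zeta> * x))"
      by (simp only: prod_roots_of_unity[OF k] prod_norm)
    also have "\<dots> = (\<Prod>\<zeta> | \<zeta> ^ k = 1. \<Prod>x\<in>#A. norm (v - \<zeta> * x))"
      by (induction A) (auto simp: prod.distrib)
    also have "\<dots> \<le> (\<Prod>\<zeta>\<in>{\<zeta>::complex. \<zeta> ^ k = 1}. H)"
    proof (rule prod_mono)
      fix \<zeta> :: complex assume z: "\<zeta> \<in> {\<zeta>. \<zeta> ^ k = 1}"
      then have z1: "norm \<zeta> = 1" using k power_eq_1_iff[of \<zeta> k] by simp
      have "norm (v - \<zeta> * x) = norm (v / \<zeta> - x)" for x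
      proof -
        have "v - \<zeta> * x = \<zeta> * (v / \<zeta> - x)" using z1 by (auto simp: field_simps)
        then show ?thesis using z1 by (simp add: norm_mult)
      qed
      then have "(\<Prod>x\<in>#A. norm (v - \<zeta> * x)) = (\<Prod>x\<in>#A. norm (v / \<zeta> - x))" by simp
      also have "\<dots> \<le> H" using H[of "v / \<zeta>"] v1 z1 by (simp add: norm_divide)
      finally show "0 \<le> (\<Prod>x\<in>#A. norm (v - \<zeta> * x)) \<and> (\<Prod>x\<in>#A. norm (v - \<zeta> * x)) \<le> H"
        by (auto intro: prod_mset_nonneg)
    qed
    also have "\<dots> = H ^ k" using card by simp
    finally show ?thesis .
  qed
  then have "norm (\<Sum>x\<in>#image_mset (\<lambda>x. x ^ k) A. x) \<le> 2 * ln (H ^ k)"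
    using unit by (intro norm_sum_unit_roots_le(1)) (auto simp: norm_power)
  then show ?thesis using H1 by (simp add: ln_realpow image_mset.compositionality o_def)
qed


section \<open>Radial concentration of the roots\<close>

lemma ln_prod_mset:
  fixes f :: "'a \<Rightarrow> real"
  assumes "\<And>x. x \<in># A \<Longrightarrow> f x > 0"
  shows "(\<Prod>x\<in>#A. f x) > 0 \<and> ln (\<Prod>x\<in>#A. f x) = (\<Sum>x\<in>#A. ln (f x))"
  using assms
proof (induction A)
  case (add x A)
  then have "f x > 0" by simp
  with add show ?case by (simp add: ln_mult_pos)
qed simp

lemma sqrt_prod_mset: "sqrt (\<Prod>x\<in>#A. f x) = (\<Prod>x\<in>#A. sqrt (f x))"
  by (induction A) (auto simp: real_sqrt_mult)

text \<open>Schur's inequality multiplied over all roots. For a monic polynomial the product of the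
  root moduli is the modulus of the constant coefficient, so \<open>H\<close> bounds the maximum on
  the circle after division by the geometric mean of the end coefficients.\<close>

lemma prod_radial_projection_le:
  fixes A :: "complex multiset"
  assumes nz: "\<And>x. x \<in># A \<Longrightarrow> x \<noteq> 0"
    and H: "\<And>u. norm u = 1 \<Longrightarrow> (\<Prod>x\<in>#A. norm (u - x)) \<le> H * sqrt (\<Prod>x\<in>#A. norm x)"
    and u: "norm u = 1"
  shows "(\<Prod>x\<in>#image_mset sgn A. norm (u - x)) \<le> H"
proof -
  have pos: "sqrt (\<Prod>x\<in>#A. norm x) > 0"
    using ln_prod_mset[of A norm] nz by simp
  have "(\<Prod>x\<in>#A. norm (u - sgn x)) * sqrt (\<Prod>x\<in>#A. norm x)
      = (\<Prod>x\<in>#A. norm (u - sgn x) * sqrt (norm x))"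
    by (simp add: sqrt_prod_mset prod_mset.distrib)
  also have "\<dots> \<le> (\<Prod>x\<in>#A. norm (u - x))"
    by (rule prod_mset_mono_real) (use norm_diff_sgn_mult_sqrt_le[OF u] nz in auto)
  also have "\<dots> \<le> H * sqrt (\<Prod>x\<in>#A. norm x)" by (rule H[OF u])
  finally show ?thesis
    using pos by (simp add: image_mset.compositionality o_def)
qed

text \<open>Replacing every linear factor with a root inside the disc by its Blaschke reflection does not change
  the modulus on the circle; the maximum principle is then applied at the origin.\<close>

lemma sum_abs_ln_norm_le:
  fixes A :: "complex multiset"
  assumes nz: "\<And>x. x \<in># A \<Longrightarrow> x \<noteq> 0"
    and H: "\<And>u. norm u = 1 \<Longrightarrow> (\<Prod>x\<in>#A. norm (u - x)) \<le> H * sqrt (\<Prod>x\<in>#A. norm x)"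
  shows "(\<Sum>x\<in>#A. \<bar>ln (norm x)\<bar>) \<le> 2 * ln H"
proof -
  define b where "b = (\<lambda>(x::complex) z. if norm x < 1 then 1 - z * cnj x else z - x)"
  define f where "f = (\<lambda>z. \<Prod>x\<in>#A. b x z)"
  define P where "P = (\<Prod>x\<in>#A. norm x)"
  have P: "P > 0" "ln P = (\<Sum>x\<in>#A. ln (norm x))"
    using ln_prod_mset[of A norm] nz by (simp_all add: P_def)
  have nb: "norm (b x u) = norm (u - x)" if u: "norm u = 1" for x u
  proof -
    have "u * cnj u = 1" using u by (simp add: complex_norm_square[symmetric])
    then have "u * cnj (u - x) = 1 - u * cnj x" by (simp add: algebra_simps)
    then have "norm (1 - u * cnj x) = norm (u - x)"
      by (metis complex_mod_cnj mult_1 norm_mult u)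
    then show ?thesis by (simp add: b_def)
  qed
  have "norm (f 0) \<le> H * sqrt P"
  proof (rule unit_circle_max_modulus[of f])
    show "f holomorphic_on UNIV"
      unfolding f_def
    proof (rule holomorphic_on_prod_mset[of A b])
      show "b x holomorphic_on UNIV" for x
        by (cases "norm x < 1") (auto simp: b_def intro!: holomorphic_intros)
    qed
    show "norm (f u) \<le> H * sqrt P" if "norm u = 1" for u
      using H[OF that] nb[OF that] by (simp add: f_def norm_prod_mset P_def)
  qed auto
  \<comment> \<open>At the origin a reflected factor contributes 1 and an unreflected one
    \<open>norm x\<close>.\<close>
  moreover have "norm (f 0) = (\<Prod>x\<in>#A. max 1 (norm x))"
    unfolding f_def norm_prod_mset b_def by (intro arg_cong[where f = prod_mset] image_mset_cong) auto
  ultimately have le: "(\<Prod>x\<in>#A. max 1 (norm x)) \<le> H * sqrt P" by simp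
  have L: "(\<Prod>x\<in>#A. max 1 (norm x)) > 0"
    "ln (\<Prod>x\<in>#A. max 1 (norm x)) = (\<Sum>x\<in>#A. ln (max 1 (norm x)))"
    using ln_prod_mset[of A "\<lambda>x. max 1 (norm x)"] by (simp_all add: less_max_iff_disj)
  then have Hp: "H > 0" using le P(1) by (metis less_le_trans real_sqrt_gt_0_iff zero_less_mult_pos2)
  have "(\<Sum>x\<in>#A. ln (max 1 (norm x))) \<le> ln (H * sqrt P)"
    using le L by (metis ln_le_cancel_iff order_less_le_trans)
  also have "\<dots> = ln H + ln P / 2"
    using Hp P(1) by (simp add: ln_mult ln_sqrt)
  finally have "2 * (\<Sum>x\<in>#A. ln (max 1 (norm x))) - (\<Sum>x\<in>#A. ln (norm x)) \<le> 2 * ln H"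
    using P(2) by simp
  \<comment> \<open>For t > 0, |ln t| = 2 ln (max 1 t) - ln t. Doubling turns the square root in the
    bound into the full \<open>P\<close>, whose logarithm then cancels.\<close>
  moreover have "(\<Sum>x\<in>#A. \<bar>ln (norm x)\<bar>) =
      2 * (\<Sum>x\<in>#A. ln (max 1 (norm x))) - (\<Sum>x\<in>#A. ln (norm x))"
    using nz by (induction A) (auto simp: max_def abs_if algebra_simps)
  ultimately show ?thesis by simp
qed

section \<open>Averages over the circle\<close>

text \<open>Since \<open>cnj u\<close> is the inverse of \<open>u\<close> on the circle, the product
  is a Laurent polynomial there, and taking real parts folds its negative powers onto positive ones.
  The induction splits off both constant terms and cancels one \<open>u * cnj u\<close> from the
  rest.\<close>

lemma Re_mult_cnj_poly:
  fixes p q :: "complex poly"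
  shows "\<exists>s. \<forall>u\<in>sphere 0 1. Re (poly p u * cnj (poly q u)) = Re (poly s u)"
proof (induction p arbitrary: q)
  case 0
  show ?case by (rule exI[of _ 0]) simp
next
  case (pCons a p)
  obtain b q' where q: "q = pCons b q'" by (cases q)
  obtain s where s: "\<forall>u\<in>sphere 0 1. Re (poly p u * cnj (poly q' u)) = Re (poly s u)"
    using pCons.IH by blast
  show ?case
  proof (intro exI[of _ "smult (cnj a) q + smult (cnj b) (pCons 0 p) + s"] ballI)
    fix u :: complex assume u: "u \<in> sphere 0 1"
    then have uu: "u * cnj u = 1" by (simp add: complex_norm_square[symmetric])
    have "poly (pCons a p) u * cnj (poly q u) =
        a * cnj (poly q u) + cnj b * (u * poly p u) + (u * cnj u) * (poly p u * cnj (poly q' u))"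
      unfolding q by (simp add: algebra_simps)
    also have "Re \<dots> = Re (cnj a * poly q u) + Re (cnj b * (u * poly p u)) + Re (poly s u)"
      unfolding uu using s u by simp
    finally show "Re (poly (pCons a p) u * cnj (poly q u)) =
      Re (poly (smult (cnj a) q + smult (cnj b) (pCons 0 p) + s) u)"
      by (simp add: algebra_simps)
  qed
qed

text \<open>Real trigonometric polynomials are written as real parts of polynomials, so that only
  power sums with nonnegative exponents have to be controlled.\<close>

lemma trigonometric_approximation:
  fixes f :: "complex \<Rightarrow> real"
  assumes f: "continuous_on (sphere 0 1) f" and e: "e > 0"
  obtains p where "\<And>u. norm u = 1 \<Longrightarrow> \<bar>f u - Re (poly p u)\<bar> < e"
proof -
  define P where "P = (\<lambda>f :: complex \<Rightarrow> real. \<exists>p. \<forall>u\<in>sphere 0 1. f u = Re (poly p u))"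
  have "\<exists>g. P g \<and> (\<forall>x\<in>sphere 0 1. \<bar>f x - g x\<bar> < e)"
  proof (rule Stone_Weierstrass_HOL)
    show "compact (sphere (0::complex) 1)" by simp
    show "P (\<lambda>x. c)" for c
      unfolding P_def by (rule exI[of _ "[:of_real c:]"]) simp
    show "continuous_on (sphere 0 1) g" if g: "P g" for g
    proof -
      obtain p where p: "\<forall>u\<in>sphere 0 1. g u = Re (poly p u)" using g by (auto simp: P_def)
      have "continuous_on (sphere 0 1) (\<lambda>u. Re (poly p u))" by (intro continuous_intros)
      then show ?thesis by (rule continuous_on_eq) (use p in auto)
    qed
    show "P (\<lambda>x. g x + h x)" if gh: "P g \<and> P h" for g h
    proof -
      obtain p q where "\<forall>u\<in>sphere 0 1. g u = Re (poly p u)" "\<forall>u\<in>sphere 0 1. h u = Re (poly q u)"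
        using gh by (auto simp: P_def)
      then show ?thesis unfolding P_def by (intro exI[of _ "p + q"]) simp
    qed
    show "P (\<lambda>x. g x * h x)" if gh: "P g \<and> P h" for g h
    proof -
      obtain p q where pq: "\<forall>u\<in>sphere 0 1. g u = Re (poly p u)" "\<forall>u\<in>sphere 0 1. h u = Re (poly q u)"
        using gh by (auto simp: P_def)
      obtain s where s: "\<forall>u\<in>sphere 0 1. Re (poly p u * cnj (poly q u)) = Re (poly s u)"
        using Re_mult_cnj_poly by blast
      \<comment> \<open>Re a Re b = (Re (a b) + Re (a cnj b)) / 2, and \<open>s\<close> represents
        the second term.\<close>
      have "g u * h u = Re (poly (smult (1/2) (p * q + s)) u)" if u: "u \<in> sphere 0 1" for u
      proof -
        have "Re (poly s u) = Re (poly p u * cnj (poly q u))" using s u by simp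
        then show ?thesis using pq u by simp
      qed
      then show ?thesis unfolding P_def by blast
    qed
    show "\<exists>g. P g \<and> g x \<noteq> g y" if "x \<in> sphere 0 1 \<and> y \<in> sphere 0 1 \<and> x \<noteq> y" for x y
    proof (cases "Re x = Re y")
      case False
      have "P Re" unfolding P_def by (rule exI[of _ "[:0, 1:]"]) simp
      then show ?thesis using False by blast
    next
      case True
      then have "Im x \<noteq> Im y" using that by (auto simp: complex_eq_iff)
      moreover have "P Im" unfolding P_def by (rule exI[of _ "[:0, -\<i>:]"]) simp
      ultimately show ?thesis by blast
    qed
  qed (use assms in auto)
  then show ?thesis using that unfolding P_def by fastforce
qed

lemma sum_mset_sum_swap: "(\<Sum>x\<in>#A. \<Sum>k\<in>K. f k x) = (\<Sum>k\<in>K. \<Sum>x\<in>#A. f k x)"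
  for f :: "'b \<Rightarrow> 'a \<Rightarrow> 'c :: comm_monoid_add"
  by (induction A) (auto simp: sum.distrib)

text \<open>The constant coefficient of \<open>p\<close> gives the main term; every other
  coefficient meets a power sum. The constant in the error depends on \<open>p\<close> but not on
  \<open>A\<close>, so the trigonometric approximation can be fixed before the roots are
  known.\<close>

lemma sum_trigonometric_bound:
  fixes A :: "complex multiset"
  assumes h: "\<And>k. k > 0 \<Longrightarrow> norm (\<Sum>x\<in>#A. x ^ k) \<le> real k * h"
  shows "\<bar>(\<Sum>x\<in>#A. Re (poly p x)) - real (size A) * Re (coeff p 0)\<bar>
    \<le> (\<Sum>k=1..degree p. norm (coeff p k) * real k) * h"
proof -
  have "(\<Sum>x\<in>#A. poly p x) = (\<Sum>k\<le>degree p. coeff p k * (\<Sum>x\<in>#A. x ^ k))"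
    by (simp add: poly_altdef sum_mset_sum_swap sum_mset_distrib_left)
  also have "{..degree p} = insert 0 {1..degree p}" by auto
  also have "(\<Sum>k\<in>\<dots>. coeff p k * (\<Sum>x\<in>#A. x ^ k)) =
    of_nat (size A) * coeff p 0 + (\<Sum>k=1..degree p. coeff p k * (\<Sum>x\<in>#A. x ^ k))"
    by (simp add: mult.commute)
  finally have eq: "(\<Sum>x\<in>#A. poly p x) - of_nat (size A) * coeff p 0
    = (\<Sum>k=1..degree p. coeff p k * (\<Sum>x\<in>#A. x ^ k))" by simp
  have "(\<Sum>x\<in>#A. Re (poly p x)) = Re (\<Sum>x\<in>#A. poly p x)"
    by (induction A) auto
  then have "\<bar>(\<Sum>x\<in>#A. Re (poly p x)) - real (size A) * Re (coeff p 0)\<bar>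
    = \<bar>Re ((\<Sum>x\<in>#A. poly p x) - of_nat (size A) * coeff p 0)\<bar>" by simp
  also have "\<dots> \<le> norm (\<Sum>k=1..degree p. coeff p k * (\<Sum>x\<in>#A. x ^ k))"
    unfolding eq by (rule abs_Re_le_cmod)
  also have "\<dots> \<le> (\<Sum>k=1..degree p. norm (coeff p k) * (real k * h))"
    by (rule sum_norm_le) (auto simp: norm_mult intro!: mult_left_mono h)
  finally show ?thesis by (simp add: sum_distrib_right mult.assoc)
qed

section \<open>Means over the uniform angle\<close>

lemma cis_power_integral:
  assumes k: "k > 0"
  shows "(\<integral>t. indicator {0..2 * pi} t *\<^sub>R cis (real k * t) \<partial>lborel) = 0"
proof -
  have d: "((\<lambda>t. cis (real k * t) / (\<i> * of_nat k)) has_vector_derivative cis (real k * t)) (at t within S)" for t S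
  proof -
    have "((\<lambda>z. exp (c * z) / c) has_field_derivative exp (c * of_real t)) (at (of_real t))"
      if "c \<noteq> 0" for c :: complex
      using that by (auto intro!: derivative_eq_intros)
    from has_vector_derivative_real_field[OF this[of "\<i> * of_nat k"], of S] k
    have "((\<lambda>t. exp (\<i> * of_real (real k * t)) / (\<i> * of_nat k)) has_vector_derivative
        exp (\<i> * of_real (real k * t))) (at t within S)"
      by (simp add: mult.assoc)
    then show ?thesis by (simp add: cis_conv_exp)
  qed
  have c: "continuous_on {0..2*pi} (\<lambda>t. cis (real k * t))" by (intro continuous_intros)
  note F = has_bochner_integral_FTC_Icc[of 0 "2 * pi" "\<lambda>t. cis (real k * t) / (\<i> * of_nat k)", OF _ d c]
  have "cis (real k * (2 * pi)) = 1"
    using cis_multiple_2pi[of "real k"] by (simp add: mult.commute mult.left_commute)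
  then have "has_bochner_integral lborel (\<lambda>t. indicator {0..2 * pi} t *\<^sub>R cis (real k * t)) 0"
    using F by simp
  then show ?thesis by (simp add: has_bochner_integral_iff)
qed

lemma integral_uniform_circle:
  fixes f :: "complex \<Rightarrow> real"
  assumes [measurable]: "f \<in> borel_measurable borel"
  shows "(\<integral>z. f z \<partial>uniform_circle r) =
    (\<integral>t. f (of_real r * cis t) \<partial>uniform_measure lborel {0..2 * pi})"
  unfolding uniform_circle_def
proof (rule integral_distr)
  have "(\<lambda>t. of_real r * cis t) \<in> borel_measurable borel"
    by (intro borel_measurable_continuous_onI continuous_intros)
  then show "(\<lambda>t. complex_of_real r * cis t) \<in> uniform_measure lborel {0..2 * pi} \<rightarrow>\<^sub>M borel"
    by (simp add: measurable_def)
qed measurable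

lemma prob_space_uniform_angle: "prob_space (uniform_measure lborel {0..2 * pi})"
  by (rule prob_space_uniform_measure) auto

lemma uniform_angle_density:
  "uniform_measure lborel {0..2 * pi} = density lborel (\<lambda>t. ennreal (indicator {0..2 * pi} t / (2 * pi)))"
  unfolding uniform_measure_def
  by (intro density_cong) (auto simp: indicator_def divide_ennreal simp flip: ennreal_1)

lemma integral_poly_uniform_angle:
  "(\<integral>t. poly p (cis t) \<partial>uniform_measure lborel {0..2 * pi}) = coeff p 0"
proof -
  interpret U: prob_space "uniform_measure lborel {0..2 * pi}" by (rule prob_space_uniform_angle)
  have meas: "(\<lambda>t. cis t ^ k) \<in> borel_measurable (uniform_measure lborel {0..2 * pi})" for k
  proof -
    have "(\<lambda>t. cis t ^ k) \<in> borel_measurable borel"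
      by (intro borel_measurable_continuous_onI continuous_intros)
    then show ?thesis by (simp add: measurable_def)
  qed
  have int: "integrable (uniform_measure lborel {0..2 * pi}) (\<lambda>t. cis t ^ k)" for k
    by (rule U.integrable_const_bound[of _ 1]) (auto simp: norm_power meas)
  have 0: "(\<integral>t. cis t ^ k \<partial>uniform_measure lborel {0..2 * pi}) = 0" if "k > 0" for k
  proof -
    have "(\<integral>t. cis t ^ k \<partial>uniform_measure lborel {0..2 * pi})
      = (\<integral>t. (indicator {0..2 * pi} t / (2 * pi)) *\<^sub>R cis (real k * t) \<partial>lborel)"
      unfolding uniform_angle_density Complex.DeMoivre
      by (rule integral_density) (auto intro!: borel_measurable_continuous_onI continuous_intros)
    also have "\<dots> = (\<integral>t. (1 / (2 * pi)) *\<^sub>R (indicator {0..2 * pi} t *\<^sub>R cis (real k * t)) \<partial>lborel)"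
      by (rule Bochner_Integration.integral_cong) auto
    also have "\<dots> = 0"
      unfolding integral_scaleR_right cis_power_integral[OF that] by simp
    finally show ?thesis .
  qed
  have "(\<integral>t. poly p (cis t) \<partial>uniform_measure lborel {0..2 * pi}) =
    (\<Sum>k\<le>degree p. coeff p k * (\<integral>t. cis t ^ k \<partial>uniform_measure lborel {0..2 * pi}))"
    unfolding poly_altdef using int by (subst Bochner_Integration.integral_sum) auto
  also have "\<dots> = (\<Sum>k\<in>{0}. coeff p k * (\<integral>t. cis t ^ k \<partial>uniform_measure lborel {0..2 * pi}))"
    by (rule sum.mono_neutral_right) (auto simp: 0)
  also have "\<dots> = coeff p 0" using U.prob_space by simp
  finally show ?thesis .
qed

text \<open>The mean of \<open>Re (poly p u)\<close> over the unit circle is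
  \<open>Re (coeff p 0)\<close>, which is also the main term of the sum over the projected roots;
  this number links the root average to the circle average.\<close>

lemma uniform_circle_approx:
  fixes f :: "complex \<Rightarrow> real"
  assumes f: "continuous_on UNIV f" and r: "r > 0"
    and p: "\<And>u. norm u = 1 \<Longrightarrow> \<bar>f (of_real r * u) - Re (poly p u)\<bar> \<le> e"
  shows "\<bar>(\<integral>z. f z \<partial>uniform_circle r) - Re (coeff p 0)\<bar> \<le> e"
proof -
  let ?U = "uniform_measure lborel {0..2 * pi}"
  interpret U: prob_space ?U by (rule prob_space_uniform_angle)
  have m[measurable]: "f \<in> borel_measurable borel" using f by (rule borel_measurable_continuous_onI)
  have m1: "(\<lambda>t. f (of_real r * cis t)) \<in> borel_measurable ?U"
  proof -
    have "(\<lambda>t. f (of_real r * cis t)) \<in> borel_measurable borel"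
      by (intro borel_measurable_continuous_onI continuous_intros continuous_on_compose2[OF f]) auto
    then show ?thesis by (simp add: measurable_def)
  qed
  have m2: "(\<lambda>t. poly p (cis t)) \<in> borel_measurable ?U"
  proof -
    have "(\<lambda>t. poly p (cis t)) \<in> borel_measurable borel"
      by (intro borel_measurable_continuous_onI continuous_intros) 
    then show ?thesis by (simp add: measurable_def)
  qed
  have "compact (sphere (0::complex) r)" by simp
  then have "bounded (f ` sphere 0 r)"
    by (intro compact_imp_bounded compact_continuous_image continuous_on_subset[OF f]) auto
  then obtain M where M: "\<forall>z\<in>sphere 0 r. norm (f z) \<le> M"
    unfolding bounded_iff by auto
  have i1: "integrable ?U (\<lambda>t. f (of_real r * cis t))"
    by (rule U.integrable_const_bound[of _ M]) (use M r m1 in \<open>auto simp: norm_mult\<close>)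
  have "bounded (poly p ` sphere 0 1)"
    by (intro compact_imp_bounded compact_continuous_image continuous_intros) auto
  then obtain M' where M': "\<forall>z\<in>sphere 0 1. norm (poly p z) \<le> M'"
    unfolding bounded_iff by auto
  have i2: "integrable ?U (\<lambda>t. poly p (cis t))"
    by (rule U.integrable_const_bound[of _ M']) (use M' m2 in auto)
  have i3: "integrable ?U (\<lambda>t. Re (poly p (cis t)))" using i2 by simp
  have "(\<integral>z. f z \<partial>uniform_circle r) - Re (coeff p 0)
    = (\<integral>t. f (of_real r * cis t) \<partial>?U) - (\<integral>t. Re (poly p (cis t)) \<partial>?U)"
    using integral_uniform_circle[OF m] integral_poly_uniform_angle[of p] integral_Re[OF i2] by simp
  also have "\<dots> = (\<integral>t. f (of_real r * cis t) - Re (poly p (cis t)) \<partial>?U)"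
    using i1 i3 by simp
  finally have eq: "(\<integral>z. f z \<partial>uniform_circle r) - Re (coeff p 0) = \<dots>" .
  have "\<bar>\<integral>t. f (of_real r * cis t) - Re (poly p (cis t)) \<partial>?U\<bar>
     \<le> (\<integral>t. \<bar>f (of_real r * cis t) - Re (poly p (cis t))\<bar> \<partial>?U)"
    by (rule integral_abs_bound)
  also have "\<dots> \<le> (\<integral>t. e \<partial>?U)"
    using i1 i3 p by (intro integral_mono) auto
  also have "\<dots> = e" using U.prob_space by simp
  finally show ?thesis unfolding eq .
qed


section \<open>Equidistribution of the roots\<close>

lemma compact_support_bounded:
  fixes \<phi> :: "complex \<Rightarrow> real"
  assumes "continuous_on UNIV \<phi>" "compact (closure {z. \<phi> z \<noteq> 0})"
  obtains M where "M \<ge> 0" "\<And>z. \<bar>\<phi> z\<bar> \<le> M"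
proof -
  have "bounded (\<phi> ` closure {z. \<phi> z \<noteq> 0})"
    using assms by (intro compact_imp_bounded compact_continuous_image continuous_on_subset[OF assms(1)]) auto
  then obtain M where M: "\<forall>z\<in>closure {z. \<phi> z \<noteq> 0}. norm (\<phi> z) \<le> M"
    unfolding bounded_iff by auto
  have "\<bar>\<phi> z\<bar> \<le> max 0 M" for z
  proof (cases "\<phi> z = 0")
    case False
    then have "z \<in> closure {z. \<phi> z \<noteq> 0}" by (intro subsetD[OF closure_subset]) simp
    then have "norm (\<phi> z) \<le> M" using M by blast
    then show ?thesis by simp
  qed auto
  then show ?thesis using that[of "max 0 M"] by simp
qed

lemma sum_mset_subtractf: "(\<Sum>x\<in>#A. f x - g x) = (\<Sum>x\<in>#A. f x) - (\<Sum>x\<in>#A. g x)"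
  for f g :: "'a \<Rightarrow> 'b :: ab_group_add"
  by (induction A) auto

text \<open>Near the circle, uniform continuity gives \<open>e\<close>; where
  \<open>\<bar>ln (norm y)\<bar> \<ge> t\<close>, the oscillation of at most \<open>2 * M\<close> is
  absorbed by \<open>2 * M / t\<close> times that logarithm. Summed over the roots, the logarithms
  are what the Jensen bound controls, so roots far from the circle need not be counted.\<close>

lemma radial_projection_bound:
  fixes \<phi> :: "complex \<Rightarrow> real"
  assumes c: "continuous_on UNIV \<phi>" and M: "\<And>z. \<bar>\<phi> z\<bar> \<le> M" and r: "r > 0" and e: "e > 0"
  obtains K where "K \<ge> 0"
    "\<And>y. y \<noteq> 0 \<Longrightarrow> \<bar>\<phi> (of_real r * y) - \<phi> (of_real r * sgn y)\<bar> \<le> e + K * \<bar>ln (norm y)\<bar>"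
proof -
  have M0: "M \<ge> 0" using M[of 0] by simp
  have "uniformly_continuous_on (cball 0 (2 * r)) \<phi>"
    by (intro compact_uniformly_continuous continuous_on_subset[OF c]) auto
  then obtain d where d: "d > 0" "\<And>x z. x \<in> cball 0 (2 * r) \<Longrightarrow> z \<in> cball 0 (2 * r) \<Longrightarrow>
      dist z x < d \<Longrightarrow> dist (\<phi> z) (\<phi> x) < e"
    unfolding uniformly_continuous_on_def using e by metis
  have "isCont exp (0::real)" by simp
  \<comment> \<open>The bound 1 keeps \<open>of_real r * y\<close> in the ball of radius
    \<open>2 * r\<close> on which \<phi> is uniformly continuous; \<open>d / r\<close> makes its
    distance to its projection less than \<open>d\<close>.\<close>
  moreover have "min 1 (d / r) > 0" using d(1) r by simp
  ultimately obtain t where "t > 0" "\<forall>x. dist x (0::real) < t \<longrightarrow> dist (exp x) (exp 0) < min 1 (d / r)"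
    unfolding continuous_at_eps_delta by blast
  then have t: "t > 0" and t2: "\<And>x::real. \<bar>x\<bar> < t \<Longrightarrow> \<bar>exp x - 1\<bar> < min 1 (d / r)"
    by (auto simp: dist_real_def)
  show ?thesis
  proof (rule that[of "2 * M / t"])
    show "2 * M / t \<ge> 0" using M0 t by simp
    fix y :: complex assume y: "y \<noteq> 0"
    show "\<bar>\<phi> (of_real r * y) - \<phi> (of_real r * sgn y)\<bar> \<le> e + 2 * M / t * \<bar>ln (norm y)\<bar>"
    proof (cases "\<bar>ln (norm y)\<bar> < t")
      case True
      have n: "\<bar>norm y - 1\<bar> < min 1 (d / r)" using t2[OF True] y by simp
      have "y = of_real (norm y) * sgn y" using y by (simp add: sgn_div_norm scaleR_conv_of_real)
      then have "of_real r * y - of_real r * sgn y = of_real (r * (norm y - 1)) * sgn y"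
        by (simp add: algebra_simps)
      then have "dist (of_real r * y) (of_real r * sgn y) = r * \<bar>norm y - 1\<bar>"
        using y r by (simp add: dist_norm norm_mult norm_sgn abs_mult del: of_real_mult of_real_diff)
      also have "\<dots> < d" using n r by (simp add: field_simps)
      finally have "dist (\<phi> (of_real r * y)) (\<phi> (of_real r * sgn y)) < e"
        using n r y by (intro d(2)) (auto simp: norm_mult norm_sgn)
      moreover have "0 \<le> 2 * M / t * \<bar>ln (norm y)\<bar>" using M0 t by simp
      ultimately show ?thesis by (simp add: dist_real_def)
    next
      case False
      have "\<bar>\<phi> (of_real r * y) - \<phi> (of_real r * sgn y)\<bar> \<le> 2 * M"
        using M[of "of_real r * y"] M[of "of_real r * sgn y"] by linarith
      also have "\<dots> = 2 * M / t * t" using t by simp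
      also have "\<dots> \<le> 2 * M / t * \<bar>ln (norm y)\<bar>"
        using False M0 t by (intro mult_left_mono) auto
      finally show ?thesis using e by simp
    qed
  qed
qed

text \<open>Puts the polynomial in the form required by the estimates on the unit circle: roots are
  divided by \<open>r\<close>, and zero roots are set aside because they have neither a direction
  nor a logarithm. The last equation is Vieta's formula for the lowest nonzero coefficient.\<close>

lemma proots_scaled_decomposition:
  fixes p :: "complex poly"
  assumes p: "p \<noteq> 0" and r: "r > 0"
  obtains A where
    "proots p = replicate_mset (order 0 p) 0 + image_mset (\<lambda>y. of_real r * y) A"
    "\<And>y. y \<in># A \<Longrightarrow> y \<noteq> 0"
    "size A + order 0 p = degree p"
    "\<And>u. norm (poly p (of_real r * u)) =
       norm (lead_coeff p) * r ^ degree p * norm u ^ order 0 p * (\<Prod>y\<in>#A. norm (u - y))"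
    "norm (coeff p (order 0 p)) * r ^ order 0 p = norm (lead_coeff p) * r ^ degree p * (\<Prod>y\<in>#A. norm y)"
proof -
  define N where "N = filter_mset (\<lambda>x. x \<noteq> 0) (proots p)"
  define A where "A = image_mset (\<lambda>x. x / of_real r) N"
  have NA: "N = image_mset (\<lambda>y. of_real r * y) A"
    using r by (simp add: A_def image_mset.compositionality o_def)
  have split: "proots p = replicate_mset (order 0 p) 0 + N"
    using p by (intro multiset_eqI) (auto simp: N_def)
  have nz: "y \<noteq> 0" if "y \<in># A" for y using that r by (auto simp: A_def N_def)
  have sz: "size A + order 0 p = degree p"
    using size_proots_complex[of p] unfolding split by (simp add: A_def)
  define q where "q = smult (lead_coeff p) (\<Prod>x\<in>#N. [:-x, 1:])"
  have "p = smult (lead_coeff p) (\<Prod>x\<in>#proots p. [:-x, 1:])"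
    by (rule complex_poly_decompose_multiset[symmetric])
  also have "\<dots> = monom 1 (order 0 p) * q"
    unfolding split q_def by (simp add: monom_altdef)
  finally have pq: "p = monom 1 (order 0 p) * q" .
  have prodA: "(\<Prod>x\<in>#image_mset (\<lambda>y. of_real r * y) A. norm (of_real r * u - x)) = r ^ size A * (\<Prod>y\<in>#A. norm (u - y))"
    for u :: complex and A
  proof (induction A)
    case (add x A)
    have "norm (of_real r * u - of_real r * x) = r * norm (u - x)"
      using r by (simp add: norm_mult flip: right_diff_distrib)
    then show ?case using add by simp
  qed simp
  have q: "norm (poly q (of_real r * u)) = norm (lead_coeff p) * r ^ size A * (\<Prod>y\<in>#A. norm (u - y))" for u
    unfolding q_def by (simp add: norm_mult poly_prod_mset norm_prod_mset image_mset.compositionality o_def)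
      (use prodA[of u A] in \<open>simp add: NA image_mset.compositionality o_def\<close>)
  have dp: "r ^ degree p = r ^ order 0 p * r ^ size A"
    using sz by (metis add.commute power_add)
  show ?thesis
  proof (rule that[of A])
    show "norm (poly p (of_real r * u)) =
       norm (lead_coeff p) * r ^ degree p * norm u ^ order 0 p * (\<Prod>y\<in>#A. norm (u - y))" for u
    proof -
      have "norm (poly p (of_real r * u)) = norm ((of_real r * u) ^ order 0 p * poly q (of_real r * u))"
        by (subst pq) (simp add: poly_monom)
      also have "\<dots> = r ^ order 0 p * norm u ^ order 0 p * norm (poly q (of_real r * u))"
        using r by (simp add: norm_mult norm_power power_mult_distrib)
      finally show ?thesis unfolding q dp by (simp add: mult_ac)
    qed
    have "coeff p (order 0 p) = coeff (monom 1 (order 0 p) * q) (order 0 p)"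
      using pq by metis
    also have "\<dots> = poly q (of_real r * 0)"
      by (simp add: coeff_monom_mult poly_0_coeff_0)
    finally show "norm (coeff p (order 0 p)) * r ^ order 0 p = norm (lead_coeff p) * r ^ degree p * (\<Prod>y\<in>#A. norm y)"
      unfolding dp using q[of 0] by simp
  qed (use split NA nz sz in auto)
qed

text \<open>A qualitative form of the Erdos--Turan equidistribution theorem.\<close>

lemma root_average_close:
  fixes \<phi> :: "complex \<Rightarrow> real"
  assumes c: "continuous_on UNIV \<phi>" and supp: "compact (closure {z. \<phi> z \<noteq> 0})"
    and r: "r > 0" and e: "e > 0"
  obtains C where "C \<ge> 0"
    "\<And>(n::nat) (p::complex poly) (\<epsilon>::real). \<lbrakk>n > 0; p \<noteq> 0; degree p \<le> n; \<epsilon> \<ge> 0;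
      real (order 0 p) \<le> \<epsilon> * n; real (n - degree p) \<le> \<epsilon> * n;
      \<And>z. norm z = r \<Longrightarrow> norm (poly p z) \<le> exp (\<epsilon> * n);
      exp (- (\<epsilon> * n)) \<le> norm (coeff p (order 0 p)) * r ^ order 0 p;
      exp (- (\<epsilon> * n)) \<le> norm (lead_coeff p) * r ^ degree p\<rbrakk>
      \<Longrightarrow> \<bar>(\<Sum>z\<in>#proots p. \<phi> z) / real n - (\<integral>z. \<phi> z \<partial>uniform_circle r)\<bar> \<le> e + C * \<epsilon>"
proof -
  define I where "I = (\<integral>z. \<phi> z \<partial>uniform_circle r)"
  obtain M where M: "M \<ge> 0" "\<And>z. \<bar>\<phi> z\<bar> \<le> M" using compact_support_bounded[OF c supp] by blast
  \<comment> \<open>One third each for replacing the roots by their projections, \<phi> by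
    \<open>T\<close> at the projected roots, and the circle mean of \<phi> by the constant
    coefficient of \<open>T\<close>.\<close>
  have e3: "e / 3 > 0" using e by simp
  obtain K where K: "K \<ge> 0" "\<And>y. y \<noteq> 0 \<Longrightarrow>
      \<bar>\<phi> (of_real r * y) - \<phi> (of_real r * sgn y)\<bar> \<le> e / 3 + K * \<bar>ln (norm y)\<bar>"
    using radial_projection_bound[OF c M(2) r e3] by blast
  have "continuous_on (sphere 0 1) (\<lambda>u. \<phi> (of_real r * u))"
    by (intro continuous_on_compose2[OF c] continuous_intros) auto
  then obtain T where T: "\<And>u. norm u = 1 \<Longrightarrow> \<bar>\<phi> (of_real r * u) - Re (poly T u)\<bar> < e / 3"
    using trigonometric_approximation[OF _ e3] by blast
  define J where "J = Re (coeff T 0)"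
  have J: "\<bar>I - J\<bar> \<le> e / 3"
    unfolding I_def J_def by (rule uniform_circle_approx[OF c r]) (use T in force)
  define S where "S = (\<Sum>k=1..degree T. norm (coeff T k) * real k)"
  have S0: "S \<ge> 0" unfolding S_def by (intro sum_nonneg) auto
  show ?thesis
  \<comment> \<open>Errors in units of \<open>\<epsilon> * n\<close>: \<open>M\<close> for the roots
    at 0, \<open>4 * K\<close> for the radial displacement, \<open>4 * S\<close> for the moments,
    \<open>2 * \<bar>I\<bar>\<close> because \<open>A\<close> falls short of \<open>n\<close> roots
    by at most \<open>2 * \<epsilon> * n\<close>. The coefficient of \<open>M\<close> is rounded
    up.\<close>
  proof (rule that[of "2 * (M + \<bar>I\<bar>) + 4 * K + 4 * S"])
    show "0 \<le> 2 * (M + \<bar>I\<bar>) + 4 * K + 4 * S" using M(1) K(1) S0 by simp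
    fix n :: nat and p :: "complex poly" and \<epsilon> :: real
    assume n: "n > 0" and p: "p \<noteq> 0" and deg: "degree p \<le> n" and eps: "\<epsilon> \<ge> 0"
      and o: "real (order 0 p) \<le> \<epsilon> * n" and dn: "real (n - degree p) \<le> \<epsilon> * n"
      and B: "\<And>z. norm z = r \<Longrightarrow> norm (poly p z) \<le> exp (\<epsilon> * n)"
      and c0: "exp (- (\<epsilon> * n)) \<le> norm (coeff p (order 0 p)) * r ^ order 0 p"
      and c1: "exp (- (\<epsilon> * n)) \<le> norm (lead_coeff p) * r ^ degree p"
    define h where "h = \<epsilon> * real n"
    have h0: "h \<ge> 0" using eps by (simp add: h_def)
    obtain A where A: "proots p = replicate_mset (order 0 p) 0 + image_mset (\<lambda>y. of_real r * y) A"
      "\<And>y. y \<in># A \<Longrightarrow> y \<noteq> 0"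
      "size A + order 0 p = degree p"
      "\<And>u. norm (poly p (of_real r * u)) =
         norm (lead_coeff p) * r ^ degree p * norm u ^ order 0 p * (\<Prod>y\<in>#A. norm (u - y))"
      "norm (coeff p (order 0 p)) * r ^ order 0 p = norm (lead_coeff p) * r ^ degree p * (\<Prod>y\<in>#A. norm y)"
      using proots_scaled_decomposition[OF p r] by metis
    define l where "l = norm (lead_coeff p) * r ^ degree p"
    define P where "P = (\<Prod>y\<in>#A. norm y)"
    have l: "l \<ge> exp (- h)" "l > 0"
      using c1 exp_gt_zero[of "-h"] unfolding l_def h_def by linarith+
    have lP: "l * P \<ge> exp (- h)" using c0 unfolding A(5) l_def P_def h_def by simp
    \<comment> \<open>\<open>l\<close> and \<open>l * P\<close> are the rescaled end coefficients
      and \<open>l * sqrt P\<close> is their geometric mean. Dividing the upper bound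
      \<open>exp h\<close> by this lower bound is the origin of \<open>exp (2 * h)\<close>
      below.\<close>
    have "exp (- h) = sqrt (exp (- h) * exp (- h))" by simp
    also have "\<dots> \<le> sqrt (l * (l * P))"
      using l lP by (intro real_sqrt_le_mono mult_mono) auto
    also have "\<dots> = l * sqrt P" using l by (simp add: real_sqrt_mult)
    finally have lsP: "exp (- h) \<le> l * sqrt P" .
    have H: "(\<Prod>y\<in>#A. norm (u - y)) \<le> exp (2 * h) * sqrt (\<Prod>y\<in>#A. norm y)" if u: "norm u = 1" for u
    proof -
      have "norm (of_real r * u) = r" using u r by (simp add: norm_mult)
      from B[OF this] have "l * (\<Prod>y\<in>#A. norm (u - y)) \<le> exp h"
        unfolding A(4) u l_def h_def by simp
      also have "\<dots> = exp (2 * h) * exp (- h)" by (simp flip: exp_add)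
      also have "\<dots> \<le> exp (2 * h) * (l * sqrt P)" using lsP by simp
      finally have "l * (\<Prod>y\<in>#A. norm (u - y)) \<le> l * (exp (2 * h) * sqrt P)" by (simp add: mult_ac)
      then show ?thesis using l(2) unfolding P_def by simp
    qed
    have rad: "(\<Sum>y\<in>#A. \<bar>ln (norm y)\<bar>) \<le> 4 * h"
      using sum_abs_ln_norm_le[of A, OF A(2) H] by simp
    have mom: "norm (\<Sum>x\<in>#image_mset sgn A. x ^ k) \<le> real k * (4 * h)" if "k > 0" for k
    proof -
      have "norm (\<Sum>x\<in>#image_mset sgn A. x ^ k) \<le> 2 * real k * ln (exp (2 * h))"
      proof (rule power_sum_bound[OF _ _ that])
        show "norm x = 1" if "x \<in># image_mset sgn A" for x
          using that A(2) by (auto simp: norm_sgn)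
        show "(\<Prod>x\<in>#image_mset sgn A. norm (u - x)) \<le> exp (2 * h)" if "norm u = 1" for u
          by (rule prod_radial_projection_le[of A, OF A(2) H that])
      qed
      then show ?thesis by simp
    qed
    define s where "s = real (size A)"
    have sn: "s \<le> real n" "real n - s \<le> 2 * h"
      using A(3) deg o dn unfolding s_def h_def by linarith+
    have 1: "\<bar>(\<Sum>y\<in>#A. \<phi> (of_real r * y)) - (\<Sum>y\<in>#A. \<phi> (of_real r * sgn y))\<bar> \<le> e / 3 * s + 4 * K * h"
    proof -
      have "\<bar>(\<Sum>y\<in>#A. \<phi> (of_real r * y)) - (\<Sum>y\<in>#A. \<phi> (of_real r * sgn y))\<bar>
         = norm (\<Sum>y\<in>#A. \<phi> (of_real r * y) - \<phi> (of_real r * sgn y))"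
        by (simp add: sum_mset_subtractf)
      also have "\<dots> \<le> (\<Sum>y\<in>#A. norm (\<phi> (of_real r * y) - \<phi> (of_real r * sgn y)))"
        by (rule norm_sum_mset_le)
      also have "\<dots> \<le> (\<Sum>y\<in>#A. e / 3 + K * \<bar>ln (norm y)\<bar>)"
        by (rule sum_mset_mono) (use K(2) A(2) in auto)
      also have "\<dots> = e / 3 * s + K * (\<Sum>y\<in>#A. \<bar>ln (norm y)\<bar>)"
        by (simp add: sum_mset.distrib sum_mset_distrib_left s_def)
      also have "\<dots> \<le> e / 3 * s + K * (4 * h)"
        using rad K(1) by (intro add_left_mono mult_left_mono)
      finally show ?thesis by simp
    qed
    have 2: "\<bar>(\<Sum>y\<in>#A. \<phi> (of_real r * sgn y)) - (\<Sum>y\<in>#A. Re (poly T (sgn y)))\<bar> \<le> e / 3 * s"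
    proof -
      have "\<bar>(\<Sum>y\<in>#A. \<phi> (of_real r * sgn y)) - (\<Sum>y\<in>#A. Re (poly T (sgn y)))\<bar>
         = norm (\<Sum>y\<in>#A. \<phi> (of_real r * sgn y) - Re (poly T (sgn y)))"
        by (simp add: sum_mset_subtractf)
      also have "\<dots> \<le> (\<Sum>y\<in>#A. norm (\<phi> (of_real r * sgn y) - Re (poly T (sgn y))))"
        by (rule norm_sum_mset_le)
      also have "\<dots> \<le> (\<Sum>y\<in>#A. e / 3)"
        by (rule sum_mset_mono) (use T A(2) in \<open>force simp: norm_sgn intro: less_imp_le\<close>)
      finally show ?thesis by (simp add: s_def mult.commute)
    qed
    have 3: "\<bar>(\<Sum>y\<in>#A. Re (poly T (sgn y))) - s * J\<bar> \<le> 4 * S * h"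
      using sum_trigonometric_bound[of "image_mset sgn A" "4 * h" T] mom
      by (simp add: s_def J_def S_def image_mset.compositionality o_def)
    have 4: "\<bar>s * J - s * I\<bar> \<le> e / 3 * s"
    proof -
      have "\<bar>s * J - s * I\<bar> = s * \<bar>I - J\<bar>"
        unfolding right_diff_distrib[symmetric] abs_mult by (simp add: s_def abs_minus_commute)
      then show ?thesis using mult_left_mono[OF J, of s] by (simp add: s_def mult.commute)
    qed
    have 5: "\<bar>s * I - n * I\<bar> \<le> 2 * h * \<bar>I\<bar>"
    proof -
      have "\<bar>s * I - n * I\<bar> = (n - s) * \<bar>I\<bar>"
        unfolding left_diff_distrib[symmetric] abs_mult using sn(1) by simp
      then show ?thesis using mult_right_mono[OF sn(2), of "\<bar>I\<bar>"] by simp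
    qed
    have 6: "\<bar>(\<Sum>z\<in>#proots p. \<phi> z) - (\<Sum>y\<in>#A. \<phi> (of_real r * y))\<bar> \<le> h * M"
      unfolding A(1) using mult_mono[OF o M(2)[of 0]] h0
      by (simp add: image_mset.compositionality o_def abs_mult h_def)
    have "\<bar>(\<Sum>z\<in>#proots p. \<phi> z) - n * I\<bar> \<le> e * s + (M + 4 * K + 4 * S + 2 * \<bar>I\<bar>) * h"
    proof -
      have "(M + 4 * K + 4 * S + 2 * \<bar>I\<bar>) * h = h * M + 4 * K * h + 4 * S * h + 2 * h * \<bar>I\<bar>"
        by (simp add: algebra_simps)
      moreover have "e * s = e / 3 * s + e / 3 * s + e / 3 * s" by simp
      ultimately show ?thesis using 1 2 3 4 5 6 by linarith
    qed
    also have "\<dots> \<le> e * n + (2 * (M + \<bar>I\<bar>) + 4 * K + 4 * S) * h"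
      by (rule add_mono[OF mult_left_mono mult_right_mono]) (use sn(1) e M(1) h0 in auto)
    finally have fin: "\<bar>(\<Sum>z\<in>#proots p. \<phi> z) - n * I\<bar> \<le> (e + (2 * (M + \<bar>I\<bar>) + 4 * K + 4 * S) * \<epsilon>) * n"
      by (simp add: h_def algebra_simps)
    have "(\<Sum>z\<in>#proots p. \<phi> z) / n - I = ((\<Sum>z\<in>#proots p. \<phi> z) - n * I) / n"
      using n by (simp add: field_simps)
    then show "\<bar>(\<Sum>z\<in>#proots p. \<phi> z) / n - (\<integral>z. \<phi> z \<partial>uniform_circle r)\<bar> \<le> e + (2 * (M + \<bar>I\<bar>) + 4 * K + 4 * S) * \<epsilon>"
      using fin n unfolding I_def[symmetric] by (simp add: divide_le_eq)
  qed
qed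


section \<open>Measurability of sums over roots\<close>

lemma sum_mset_eq_sum_count:
  fixes f :: "'a \<Rightarrow> 'b :: comm_semiring_1"
  shows "(\<Sum>x\<in>#A. f x) = (\<Sum>x\<in>set_mset A. of_nat (count A x) * f x)"
proof (induction A)
  case (add x A)
  show ?case
  proof (cases "x \<in># A")
    case True
    have "(\<Sum>y\<in>set_mset (add_mset x A). of_nat (count (add_mset x A) y) * f y)
      = (\<Sum>y\<in>set_mset A. of_nat (count A y) * f y + (if y = x then f y else 0))"
      using True by (intro sum.cong) (auto simp: algebra_simps)
    also have "\<dots> = (\<Sum>y\<in>set_mset A. of_nat (count A y) * f y) + f x"
      using True by (simp add: sum.distrib sum.delta)
    finally show ?thesis using add by (simp add: add.commute)
  next
    case False
    then have "(\<Sum>y\<in>set_mset A. of_nat (count (add_mset x A) y) * f y)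
      = (\<Sum>y\<in>set_mset A. of_nat (count A y) * f y)"
      by (intro sum.cong) auto
    then show ?thesis using False add by (simp add: not_in_iff)
  qed
qed simp

text \<open>Scaling is rewritten as a constant density, to which the integration rule for densities
  applies. The zero polynomial fits in: the null measure integrates to 0 and \<open>proots 0\<close>
  is empty.\<close>

lemma integral_scaled_zero_measure:
  fixes \<phi> :: "complex \<Rightarrow> real"
  assumes [measurable]: "\<phi> \<in> borel_measurable borel" and c: "c \<ge> 0"
  shows "integral\<^sup>L (scale_measure (ennreal c) (zero_measure p)) \<phi> = c * (\<Sum>z\<in>#proots p. \<phi> z)"
proof -
  have "scale_measure (ennreal c) (zero_measure p) = density (zero_measure p) (\<lambda>_. ennreal c)"
    by (rule measure_eqI) (auto simp: emeasure_density_const)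
  then have "integral\<^sup>L (scale_measure (ennreal c) (zero_measure p)) \<phi> = (\<integral>z. c *\<^sub>R \<phi> z \<partial>zero_measure p)"
    using c by (simp add: integral_density measurable_cong_sets[OF sets_zero_measure refl])
  also have "\<dots> = c * (\<integral>z. \<phi> z \<partial>zero_measure p)" by simp
  also have "(\<integral>z. \<phi> z \<partial>zero_measure p) = (\<Sum>z\<in>#proots p. \<phi> z)"
  proof (cases "p = 0")
    case False
    have fin: "finite {z. poly p z = 0}" using False by (rule poly_roots_finite)
    have "(\<integral>z. \<phi> z \<partial>zero_measure p) =
      (\<integral>z. \<phi> z \<partial>point_measure {z. poly p z = 0} (\<lambda>z. ennreal (real (order z p))))"
      using False unfolding zero_measure_def
      by (simp add: ennreal_of_nat_eq_real_of_nat, subst integral_distr) simp_all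
    also have "\<dots> = (\<Sum>z | poly p z = 0. real (order z p) * \<phi> z)"
      using fin by (subst lebesgue_integral_point_measure_finite) auto
    also have "\<dots> = (\<Sum>z\<in>#proots p. \<phi> z)"
      unfolding sum_mset_eq_sum_count using False by (intro sum.cong) auto
    finally show ?thesis .
  qed (simp add: zero_measure_def)
  finally show ?thesis .
qed

text \<open>In characteristic 0, differentiation lowers the order of a root by exactly one.
  Multiplicity thereby becomes a system of polynomial equations in \<open>z\<close> and the
  coefficients, a form suited to measurability.\<close>

lemma order_ge_iff_pderiv:
  fixes p :: "complex poly"
  assumes "p \<noteq> 0"
  shows "j \<le> order z p \<longleftrightarrow> (\<forall>i<j. poly ((pderiv ^^ i) p) z = 0)"
  using assms
proof (induction j arbitrary: p)
  case (Suc j)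
  show ?case
  proof (cases "poly p z = 0")
    case True
    have "pderiv p \<noteq> 0"
    proof
      assume "pderiv p = 0"
      then obtain c where "p = [:c:]" by (metis degree_eq_zeroE pderiv_eq_0_iff)
      then show False using True Suc.prems by simp
    qed
    moreover have "order z p = Suc (order z (pderiv p))"
      using Suc.prems True by (rule order_pderiv)
    ultimately have "Suc j \<le> order z p \<longleftrightarrow> (\<forall>i<j. poly ((pderiv ^^ i) (pderiv p)) z = 0)"
      using Suc.IH by simp
    also have "\<dots> \<longleftrightarrow> (\<forall>i<Suc j. poly ((pderiv ^^ i) p) z = 0)"
      using True by (simp add: All_less_Suc2 funpow_Suc_right del: funpow.simps)
    finally show ?thesis .
  next
    case False
    then have "order z p = 0" by (simp add: order_root)
    moreover have "\<not> (\<forall>i<Suc j. poly ((pderiv ^^ i) p) z = 0)"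
      using False by (auto intro!: exI[of _ 0])
    ultimately show ?thesis by simp
  qed
qed simp

text \<open>On a compact set a continuous nonnegative function attains its infimum, so it has a zero
  iff its values on a countable dense subset come arbitrarily close to 0. The uncountable union over
  \<open>K\<close> is thus replaced by countable operations.\<close>

lemma sets_exists_zero_compact:
  fixes g :: "'a \<Rightarrow> complex \<Rightarrow> real"
  assumes [measurable]: "\<And>z. (\<lambda>\<omega>. g \<omega> z) \<in> borel_measurable M"
    and cont: "\<And>\<omega>. continuous_on UNIV (g \<omega>)"
    and nonneg: "\<And>\<omega> z. 0 \<le> g \<omega> z"
    and K: "compact K"
  shows "{\<omega> \<in> space M. \<exists>z\<in>K. g \<omega> z = 0} \<in> sets M"
proof (cases "K = {}")
  case False
  obtain D where D: "countable D" "D \<subseteq> K" "K \<subseteq> closure D" by (rule separable)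
  have "(\<exists>z\<in>K. g \<omega> z = 0) \<longleftrightarrow> (\<forall>n. \<exists>q\<in>D. g \<omega> q < 1 / real (Suc n))" for \<omega>
  proof safe
    fix z n assume z: "z \<in> K" "g \<omega> z = 0"
    have "isCont (g \<omega>) z" using cont[of \<omega>] by (simp add: continuous_on_eq_continuous_at)
    moreover have "0 < 1 / real (Suc n)" by simp
    ultimately obtain d where d: "d > 0" "\<And>q. dist q z < d \<Longrightarrow> dist (g \<omega> q) (g \<omega> z) < 1 / real (Suc n)"
      unfolding continuous_at_eps_delta by blast
    have "z \<in> closure D" using D(3) z(1) by blast
    then obtain q where q: "q \<in> D" "dist q z < d"
      using d(1) unfolding closure_approachable by blast
    have "g \<omega> q < 1 / real (Suc n)" using d(2)[OF q(2)] z(2) nonneg[of \<omega> q] by (simp add: dist_real_def)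
    then show "\<exists>q\<in>D. g \<omega> q < 1 / real (Suc n)" using q(1) by blast
  next
    assume *: "\<forall>n. \<exists>q\<in>D. g \<omega> q < 1 / real (Suc n)"
    obtain z where z: "z \<in> K" "\<And>q. q \<in> K \<Longrightarrow> g \<omega> z \<le> g \<omega> q"
      using continuous_attains_inf[OF K False continuous_on_subset[OF cont[of \<omega>]]] by auto
    have "g \<omega> z < 1 / real (Suc n)" for n
    proof -
      obtain q where "q \<in> D" "g \<omega> q < 1 / real (Suc n)" using * by blast
      then show ?thesis using z(2)[of q] D(2) by force
    qed
    then have "\<not> 0 < g \<omega> z"
      by (metis nat_approx_posE not_less_iff_gr_or_eq)
    then show "\<exists>z\<in>K. g \<omega> z = 0" using z(1) nonneg[of \<omega> z] by force
  qed
  then have "{\<omega> \<in> space M. \<exists>z\<in>K. g \<omega> z = 0} =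
    (\<Inter>n. \<Union>q\<in>D. {\<omega> \<in> space M. g \<omega> q < 1 / real (Suc n)})"
    using D False by auto
  also have "\<dots> \<in> sets M"
    using D(1) by (intro sets.countable_INT' sets.countable_UN') auto
  finally show ?thesis .
qed simp

text \<open>The cells are half-open squares of side \<open>1 / Suc N\<close>, so every point lies in
  exactly one; \<open>Suc\<close> excludes a division by 0 at \<open>N = 0\<close>.\<close>

definition grid_index :: "nat \<Rightarrow> complex \<Rightarrow> int \<times> int" where
  "grid_index N z = (\<lfloor>real (Suc N) * Re z\<rfloor>, \<lfloor>real (Suc N) * Im z\<rfloor>)"

definition grid_corner :: "nat \<Rightarrow> int \<times> int \<Rightarrow> complex" where
  "grid_corner N ij = Complex (of_int (fst ij) / real (Suc N)) (of_int (snd ij) / real (Suc N))"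

lemma floor_mult_div_bounds:
  fixes s x :: real
  assumes "s > 0"
  shows "x - 1 / s \<le> of_int \<lfloor>s * x\<rfloor> / s" "of_int \<lfloor>s * x\<rfloor> / s \<le> x"
proof -
  have "(s * x - 1) / s \<le> of_int \<lfloor>s * x\<rfloor> / s" "of_int \<lfloor>s * x\<rfloor> / s \<le> s * x / s"
    using assms by (intro divide_right_mono; linarith)+
  then show "x - 1 / s \<le> of_int \<lfloor>s * x\<rfloor> / s" "of_int \<lfloor>s * x\<rfloor> / s \<le> x"
    using assms by (simp_all add: diff_divide_distrib)
qed

lemma floor_mult_div_tendsto: "(\<lambda>N. of_int \<lfloor>real (Suc N) * x\<rfloor> / real (Suc N)) \<longlonglongrightarrow> x"
proof (rule tendsto_sandwich)
  show "\<forall>\<^sub>F N in sequentially. x - 1 / real (Suc N) \<le> of_int \<lfloor>real (Suc N) * x\<rfloor> / real (Suc N)"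
    by (intro always_eventually allI floor_mult_div_bounds) simp
  show "\<forall>\<^sub>F N in sequentially. of_int \<lfloor>real (Suc N) * x\<rfloor> / real (Suc N) \<le> x"
    by (intro always_eventually allI floor_mult_div_bounds) simp
  have "(\<lambda>N. x - 1 / real (Suc N)) \<longlonglongrightarrow> x - 0"
    by (intro tendsto_intros LIMSEQ_Suc lim_1_over_n)
  then show "(\<lambda>N. x - 1 / real (Suc N)) \<longlonglongrightarrow> x" by simp
qed simp

lemma grid_corner_tendsto: "(\<lambda>N. grid_corner N (grid_index N z)) \<longlonglongrightarrow> z"
  using tendsto_Complex[OF floor_mult_div_tendsto[of "Re z"] floor_mult_div_tendsto[of "Im z"]]
  by (simp add: grid_corner_def grid_index_def)

text \<open>Hitting events are known to be measurable for compact sets; a countable union of closed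
  boxes extends this to half-open cells.\<close>

lemma grid_cell_eq_UN_cbox:
  "{z. grid_index N z = (i, j)} =
    (\<Union>l. cbox (Complex (of_int i / real (Suc N)) (of_int j / real (Suc N)))
          (Complex ((of_int i + 1) / real (Suc N) - 1 / real (Suc l)) ((of_int j + 1) / real (Suc N) - 1 / real (Suc l))))"
  (is "?L = (\<Union>l. ?B l)")
proof (intro set_eqI iffI)
  fix z assume "z \<in> ?L"
  then have z: "of_int i \<le> real (Suc N) * Re z" "real (Suc N) * Re z < of_int i + 1"
    "of_int j \<le> real (Suc N) * Im z" "real (Suc N) * Im z < of_int j + 1"
    unfolding grid_index_def by (auto simp: floor_eq_iff)
  then have *: "of_int i / real (Suc N) \<le> Re z" "Re z < (of_int i + 1) / real (Suc N)"
    "of_int j / real (Suc N) \<le> Im z" "Im z < (of_int j + 1) / real (Suc N)"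
    by (simp_all add: field_simps)
  define d where "d = min ((of_int i + 1) / real (Suc N) - Re z) ((of_int j + 1) / real (Suc N) - Im z)"
  have "d > 0" using * by (simp add: d_def)
  then obtain l where "1 / real (Suc l) < d" using nat_approx_posE by blast
  then have "z \<in> ?B l" using * unfolding d_def by (auto simp: in_cbox_complex_iff)
  then show "z \<in> (\<Union>l. ?B l)" by blast
next
  fix z assume "z \<in> (\<Union>l. ?B l)"
  then obtain l where "z \<in> ?B l" by blast
  then have "of_int i / real (Suc N) \<le> Re z" "Re z \<le> (of_int i + 1) / real (Suc N) - 1 / real (Suc l)"
    "of_int j / real (Suc N) \<le> Im z" "Im z \<le> (of_int j + 1) / real (Suc N) - 1 / real (Suc l)"
    by (simp_all add: in_cbox_complex_iff del: of_nat_Suc)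
  moreover have "1 / real (Suc l) > 0" by simp
  ultimately have "of_int i / real (Suc N) \<le> Re z" "Re z < (of_int i + 1) / real (Suc N)"
    "of_int j / real (Suc N) \<le> Im z" "Im z < (of_int j + 1) / real (Suc N)"
    by linarith+
  then have "of_int i \<le> real (Suc N) * Re z" "real (Suc N) * Re z < of_int i + 1"
    "of_int j \<le> real (Suc N) * Im z" "real (Suc N) * Im z < of_int j + 1"
    by (simp_all add: field_simps)
  then show "z \<in> ?L" unfolding grid_index_def by (auto simp: floor_eq_iff)
qed

text \<open>On a fine enough grid every cell contains at most one point of the finite set, so the sum is the
  limit of sums over the grid cells that are hit.\<close>

lemma borel_measurable_sum_random_finite_set:
  fixes R :: "'a \<Rightarrow> complex set" and \<phi> :: "complex \<Rightarrow> real"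
  assumes fin: "\<And>\<omega>. finite (R \<omega>)"
    and hit: "\<And>K. compact K \<Longrightarrow> {\<omega> \<in> space M. R \<omega> \<inter> K \<noteq> {}} \<in> sets M"
    and cont: "continuous_on UNIV \<phi>"
  shows "(\<lambda>\<omega>. \<Sum>z\<in>R \<omega>. \<phi> z) \<in> borel_measurable M"
proof (rule borel_measurable_LIMSEQ_real)
  \<comment> \<open>Cells whose corner has both coordinates between \<open>-N\<close> and
    \<open>N\<close>: finitely many, so the approximating sum is measurable, and eventually
    including the cell of any given point.\<close>
  define Bx where "Bx N = {- int (Suc N * N)..int (Suc N * N)} \<times> {- int (Suc N * N)..int (Suc N * N)}" for N
  define H where "H N ij = {\<omega> \<in> space M. R \<omega> \<inter> {z. grid_index N z = ij} \<noteq> {}}" for N ij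
  have H[measurable]: "H N ij \<in> sets M" for N ij
  proof -
    obtain i j where ij: "ij = (i, j)" by (cases ij)
    have "H N ij = (\<Union>l. {\<omega> \<in> space M. R \<omega> \<inter> cbox (Complex (of_int i / real (Suc N)) (of_int j / real (Suc N)))
          (Complex ((of_int i + 1) / real (Suc N) - 1 / real (Suc l)) ((of_int j + 1) / real (Suc N) - 1 / real (Suc l))) \<noteq> {}})"
      unfolding H_def ij grid_cell_eq_UN_cbox by blast
    also have "\<dots> \<in> sets M" by (rule sets.countable_UN, rule image_subsetI, rule hit, rule compact_cbox)
    finally show ?thesis .
  qed
  show "(\<lambda>\<omega>. \<Sum>ij\<in>Bx N. \<phi> (grid_corner N ij) * indicator (H N ij) \<omega>) \<in> borel_measurable M" for N
    by measurable
  fix \<omega> assume \<omega>: "\<omega> \<in> space M"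
  have ev_inj: "\<forall>\<^sub>F N in sequentially. \<forall>z\<in>R \<omega>. \<forall>z'\<in>R \<omega>. z \<noteq> z' \<longrightarrow> grid_index N z \<noteq> grid_index N z'"
  proof (intro eventually_ball_finite[OF fin] ballI)
    fix z z' assume "z \<in> R \<omega>" "z' \<in> R \<omega>"
    show "\<forall>\<^sub>F N in sequentially. z \<noteq> z' \<longrightarrow> grid_index N z \<noteq> grid_index N z'"
    proof (cases "z = z'")
      case False
      \<comment> \<open>The corners converge to the points themselves, so those of two distinct
        points end up in disjoint neighbourhoods, whereas equal indices would force equal
        corners.\<close>
      then obtain U V where UV: "open U" "open V" "z \<in> U" "z' \<in> V" "U \<inter> V = {}"
        using hausdorff by metis
      have "\<forall>\<^sub>F N in sequentially. grid_corner N (grid_index N z) \<in> U"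
        "\<forall>\<^sub>F N in sequentially. grid_corner N (grid_index N z') \<in> V"
        using topological_tendstoD[OF grid_corner_tendsto] UV by auto
      then show ?thesis by eventually_elim (use UV in \<open>metis disjoint_iff\<close>)
    qed simp
  qed
  have ev_range: "\<forall>\<^sub>F N in sequentially. \<forall>z\<in>R \<omega>. grid_index N z \<in> Bx N"
  proof (intro eventually_ball_finite[OF fin] ballI)
    fix z assume "z \<in> R \<omega>"
    have ev: "\<forall>\<^sub>F N in sequentially. \<lfloor>real (Suc N) * x\<rfloor> \<in> {- int (Suc N * N)..int (Suc N * N)}" for x
    proof -
      have "\<forall>\<^sub>F N in sequentially. real N \<ge> \<bar>x\<bar> + 1"
        using filterlim_real_sequentially by (simp add: filterlim_at_top)
      then show ?thesis
      proof eventually_elim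
        case (elim N)
        have "real (Suc N) * (\<bar>x\<bar> + 1) \<le> real (Suc N) * real N"
          using elim by (intro mult_left_mono) auto
        moreover have "\<bar>real (Suc N) * x\<bar> = real (Suc N) * \<bar>x\<bar>" by (simp add: abs_mult)
        ultimately have "\<bar>real (Suc N) * x\<bar> + 1 \<le> real (Suc N * N)" by (simp add: algebra_simps)
        then have "real_of_int \<lfloor>real (Suc N) * x\<rfloor> \<le> real_of_int (int (Suc N * N))"
          "real_of_int (- int (Suc N * N)) \<le> real_of_int \<lfloor>real (Suc N) * x\<rfloor>"
          unfolding of_int_minus of_int_of_nat_eq by linarith+
        then show ?case unfolding of_int_le_iff by simp
      qed
    qed
    show "\<forall>\<^sub>F N in sequentially. grid_index N z \<in> Bx N"
      using ev[of "Re z"] ev[of "Im z"] by eventually_elim (simp add: grid_index_def Bx_def)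
  qed
  have "(\<lambda>N. \<Sum>z\<in>R \<omega>. \<phi> (grid_corner N (grid_index N z))) \<longlonglongrightarrow> (\<Sum>z\<in>R \<omega>. \<phi> z)"
  proof (rule tendsto_sum)
    show "(\<lambda>N. \<phi> (grid_corner N (grid_index N z))) \<longlonglongrightarrow> \<phi> z" for z
      using cont continuous_on_tendsto_compose[OF cont grid_corner_tendsto] by simp
  qed
  moreover have "\<forall>\<^sub>F N in sequentially. (\<Sum>z\<in>R \<omega>. \<phi> (grid_corner N (grid_index N z))) =
    (\<Sum>ij\<in>Bx N. \<phi> (grid_corner N ij) * indicator (H N ij) \<omega>)"
    using ev_inj ev_range
  proof eventually_elim
    case (elim N)
    have hit_iff: "\<omega> \<in> H N ij \<longleftrightarrow> ij \<in> grid_index N ` R \<omega>" for ij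
      using \<omega> by (auto simp: H_def)
    \<comment> \<open>An indicator records only whether a cell is hit; injectivity ensures that no
      point is lost.\<close>
    have "(\<Sum>z\<in>R \<omega>. \<phi> (grid_corner N (grid_index N z))) = (\<Sum>ij\<in>grid_index N ` R \<omega>. \<phi> (grid_corner N ij))"
      using elim(1) by (subst sum.reindex) (auto simp: inj_on_def)
    also have "\<dots> = (\<Sum>ij\<in>grid_index N ` R \<omega>. \<phi> (grid_corner N ij) * indicator (H N ij) \<omega>)"
      by (intro sum.cong) (auto simp: hit_iff)
    also have "\<dots> = (\<Sum>ij\<in>Bx N. \<phi> (grid_corner N ij) * indicator (H N ij) \<omega>)"
      using elim(2) by (intro sum.mono_neutral_left) (auto simp: Bx_def hit_iff)
    finally show ?case .
  qed
  ultimately show "(\<lambda>N. \<Sum>ij\<in>Bx N. \<phi> (grid_corner N ij) * indicator (H N ij) \<omega>) \<longlonglongrightarrow> (\<Sum>z\<in>R \<omega>. \<phi> z)"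
    by (rule Lim_transform_eventually)
qed

text \<open>Layer-cake argument: the multiplicity of a root is the number of
  \<open>j \<ge> 1\<close> not exceeding its order, so the sum is one over \<open>j\<close> of sums
  over the finite sets \<open>R j \<omega>\<close>. For a nonzero polynomial such a set meets
  \<open>K\<close> iff the derivatives of orders below \<open>j\<close> have a common zero in
  \<open>K\<close>, i.e. iff \<open>g j \<omega>\<close> vanishes somewhere on
  \<open>K\<close>.\<close>

lemma borel_measurable_sum_proots:
  fixes p :: "'a \<Rightarrow> complex poly" and \<phi> :: "complex \<Rightarrow> real"
  assumes deg: "\<And>\<omega>. degree (p \<omega>) \<le> n"
    and coeff: "\<And>k. (\<lambda>\<omega>. coeff (p \<omega>) k) \<in> borel_measurable M"
    and cont: "continuous_on UNIV \<phi>"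
  shows "(\<lambda>\<omega>. \<Sum>z\<in>#proots (p \<omega>). \<phi> z) \<in> borel_measurable M"
proof -
  \<comment> \<open>The case \<open>p \<omega> = 0\<close> is set apart so that the set stays
    finite; this agrees with \<open>proots 0\<close> being empty.\<close>
  define R where "R j \<omega> = (if p \<omega> = 0 then {} else {z. j \<le> order z (p \<omega>)})" for j \<omega>
  define g where "g j \<omega> z = (\<Sum>i<j. norm (poly ((pderiv ^^ i) (p \<omega>)) z))" for j \<omega> z
  have fin: "finite (R j \<omega>)" if "j \<ge> 1" for j \<omega>
  proof (cases "p \<omega> = 0")
    case False
    then have "R j \<omega> \<subseteq> {z. poly (p \<omega>) z = 0}" using that by (auto simp: R_def order_root)
    then show ?thesis using False poly_roots_finite finite_subset by blast
  qed (simp add: R_def)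
  have dcoeff: "(\<lambda>\<omega>. coeff ((pderiv ^^ i) (p \<omega>)) k) \<in> borel_measurable M" for i k
    by (induction i arbitrary: k) (auto simp: coeff_pderiv coeff)
  have ddeg: "degree ((pderiv ^^ i) (p \<omega>)) \<le> n" for i \<omega>
    by (induction i) (auto simp: deg degree_pderiv intro: le_trans[OF diff_le_self])
  have "poly ((pderiv ^^ i) (p \<omega>)) z = (\<Sum>k\<le>n. coeff ((pderiv ^^ i) (p \<omega>)) k * z ^ k)" for i \<omega> z
    using poly_as_sum_of_monoms'[OF ddeg[of i \<omega>]]
    by (metis (no_types, lifting) poly_monom poly_sum sum.cong)
  then have dpoly: "(\<lambda>\<omega>. poly ((pderiv ^^ i) (p \<omega>)) z) \<in> borel_measurable M" for i z
    using dcoeff by simp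
  have p0: "{\<omega> \<in> space M. p \<omega> \<noteq> 0} \<in> sets M"
  proof -
    have "p \<omega> \<noteq> 0 \<longleftrightarrow> (\<exists>k. coeff (p \<omega>) k \<noteq> 0)" for \<omega> by (metis coeff_0 poly_eq_iff)
    then show ?thesis using coeff by simp
  qed
  have hit: "{\<omega> \<in> space M. R j \<omega> \<inter> K \<noteq> {}} \<in> sets M" if "compact K" for j K
  proof -
    have "{\<omega> \<in> space M. R j \<omega> \<inter> K \<noteq> {}} = {\<omega> \<in> space M. p \<omega> \<noteq> 0} \<inter> {\<omega> \<in> space M. \<exists>z\<in>K. g j \<omega> z = 0}"
    proof -
      have "g j \<omega> z = 0 \<longleftrightarrow> z \<in> R j \<omega>" if "p \<omega> \<noteq> 0" for \<omega> z
        unfolding R_def g_def using that order_ge_iff_pderiv[OF that]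
        by (subst sum_nonneg_eq_0_iff) auto
      then show ?thesis by (auto simp: R_def)
    qed
    also have "\<dots> \<in> sets M"
      using dpoly that
      by (intro sets.Int p0 sets_exists_zero_compact) (auto simp: g_def intro!: sum_nonneg continuous_intros)
    finally show ?thesis .
  qed
  have "(\<Sum>z\<in>#proots (p \<omega>). \<phi> z) = (\<Sum>j=1..n. \<Sum>z\<in>R j \<omega>. \<phi> z)" for \<omega>
  proof (cases "p \<omega> = 0")
    case False
    have fr: "finite {z. poly (p \<omega>) z = 0}" using False by (rule poly_roots_finite)
    have "(\<Sum>z\<in>#proots (p \<omega>). \<phi> z) = (\<Sum>z | poly (p \<omega>) z = 0. real (order z (p \<omega>)) * \<phi> z)"
      unfolding sum_mset_eq_sum_count using False by simp
    also have "\<dots> = (\<Sum>z | poly (p \<omega>) z = 0. \<Sum>j=1..n. if j \<le> order z (p \<omega>) then \<phi> z else 0)"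
    proof (rule sum.cong[OF refl])
      fix z
      have "order z (p \<omega>) \<le> n" using order_degree[OF False] deg le_trans by blast
      then have "{j \<in> {1..n}. j \<le> order z (p \<omega>)} = {1..order z (p \<omega>)}" by auto
      then show "real (order z (p \<omega>)) * \<phi> z = (\<Sum>j=1..n. if j \<le> order z (p \<omega>) then \<phi> z else 0)"
        by (simp flip: sum.inter_filter)
    qed
    also have "\<dots> = (\<Sum>j=1..n. \<Sum>z | poly (p \<omega>) z = 0. if j \<le> order z (p \<omega>) then \<phi> z else 0)"
      by (rule sum.swap)
    also have "\<dots> = (\<Sum>j=1..n. \<Sum>z\<in>R j \<omega>. \<phi> z)"
    proof (rule sum.cong[OF refl])
      fix j assume j: "j \<in> {1..n}"
      have "{z \<in> {z. poly (p \<omega>) z = 0}. j \<le> order z (p \<omega>)} = R j \<omega>"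
        using j False by (auto simp: R_def order_root)
      then show "(\<Sum>z | poly (p \<omega>) z = 0. if j \<le> order z (p \<omega>) then \<phi> z else 0) = (\<Sum>z\<in>R j \<omega>. \<phi> z)"
        using fr by (simp flip: sum.inter_filter)
    qed
    finally show ?thesis .
  qed (simp add: R_def)
  moreover have "(\<lambda>\<omega>. \<Sum>j=1..n. \<Sum>z\<in>R j \<omega>. \<phi> z) \<in> borel_measurable M"
  proof (rule borel_measurable_sum)
    fix j assume "j \<in> {1..n}"
    then show "(\<lambda>\<omega>. \<Sum>z\<in>R j \<omega>. \<phi> z) \<in> borel_measurable M"
      by (intro borel_measurable_sum_random_finite_set fin hit cont) auto
  qed
  ultimately show ?thesis by simp
qed


section \<open>Random weighted polynomials\<close>

lemma coeff_weighted_poly: "coeff (weighted_poly \<xi> w n \<omega>) k = (if k \<le> n then \<xi> k \<omega> * w k else 0)"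
  by (simp add: weighted_poly_def coeff_sum)

lemma degree_weighted_poly_le: "degree (weighted_poly \<xi> w n \<omega>) \<le> n"
  by (rule degree_le) (simp add: coeff_weighted_poly)

text \<open>Divisibility by the power \<open>order 0 p\<close> of the variable kills all lower
  coefficients. Together with the non-vanishing at that index itself, \<open>order 0 p\<close> is
  the lowest index of a nonzero coefficient.\<close>

lemma order_0_le_coeff:
  fixes p :: "'a :: idom poly"
  assumes "coeff p k \<noteq> 0"
  shows "order 0 p \<le> k"
proof (rule ccontr)
  assume *: "\<not> order 0 p \<le> k"
  have "monom 1 (order 0 p) dvd p" using order_1[of 0 p] by (simp add: monom_altdef)
  then obtain q where "p = monom 1 (order 0 p) * q" by (rule dvdE)
  then have "coeff p k = 0" using * by (metis coeff_monom_mult not_le)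
  then show False using assms by simp
qed

lemma coeff_order_0_nonzero:
  fixes p :: "'a :: idom poly"
  assumes p: "p \<noteq> 0"
  shows "coeff p (order 0 p) \<noteq> 0"
proof
  obtain q where q: "p = [:-0, 1:] ^ order 0 p * q" "\<not> [:-0, 1:] dvd q"
    using order_decomp[OF p, of 0] by blast
  assume "coeff p (order 0 p) = 0"
  moreover have "p = monom 1 (order 0 p) * q" using q(1) by (simp add: monom_altdef)
  then have "coeff p (order 0 p) = coeff (monom 1 (order 0 p) * q) (order 0 p)"
    by (rule arg_cong)
  then have "coeff p (order 0 p) = poly q 0"
    by (simp add: coeff_monom_mult poly_0_coeff_0)
  ultimately show False using q(2) by (simp add: poly_eq_0_iff_dvd)
qed

text \<open>A vanishing weight puts the quotient at \<open>-\<infinity>\<close>, below the real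
  number \<open>L - e\<close>; this is where nonzero weights come from. Multiplication by the k-th
  power of the limiting radius removes the exponential growth rate.\<close>

lemma weights_eventually:
  fixes w :: "nat \<Rightarrow> complex" and e L :: real
  assumes w: "(\<lambda>k. ln_ext (norm (w k)) / ereal (real k)) \<longlonglongrightarrow> ereal L" and e: "e > 0"
  shows "\<forall>\<^sub>F k in sequentially. w k \<noteq> 0 \<and>
    exp (- (e * k)) \<le> norm (w k) * exp (- L) ^ k \<and> norm (w k) * exp (- L) ^ k \<le> exp (e * k)"
proof -
  have 1: "\<forall>\<^sub>F k in sequentially. ereal (L - e) < ln_ext (norm (w k)) / ereal (real k)"
    by (rule order_tendstoD(1)[OF w]) (use e in simp)
  have 2: "\<forall>\<^sub>F k in sequentially. ln_ext (norm (w k)) / ereal (real k) < ereal (L + e)"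
    by (rule order_tendstoD(2)[OF w]) (use e in simp)
  show ?thesis
    using 1 2 eventually_gt_at_top[of 0]
  proof eventually_elim
    case (elim k)
    have wk: "w k \<noteq> 0"
    proof
      assume "w k = 0"
      then have "ln_ext (norm (w k)) / ereal (real k) = -\<infinity>"
        using elim(3) by (simp add: ln_ext_def)
      then show False using elim(1) by simp
    qed
    then have "ln_ext (norm (w k)) / ereal (real k) = ereal (ln (norm (w k)) / real k)"
      using elim(3) by (simp add: ln_ext_def)
    then have "L - e < ln (norm (w k)) / real k" "ln (norm (w k)) / real k < L + e"
      using elim(1,2) by simp_all
    then have b: "- (e * k) \<le> ln (norm (w k)) - L * k" "ln (norm (w k)) - L * k \<le> e * k"
      using elim(3) by (simp_all add: field_simps)
    have "norm (w k) * exp (- L) ^ k = exp (ln (norm (w k)) - L * k)"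
      using wk by (simp add: exp_diff exp_minus exp_of_nat2_mult field_simps)
    then show ?case using b wk by simp
  qed
qed

text \<open>For large \<open>k\<close> the estimate with \<open>e * k\<close> is weakened to
  \<open>e * n\<close>; for the finitely many remaining \<open>k\<close>, any positive constant
  eventually lies between \<open>exp (- (e * n))\<close> and \<open>exp (e * n)\<close>.\<close>

lemma weights_uniform_eventually:
  fixes w :: "nat \<Rightarrow> complex" and e L :: real
  assumes w: "(\<lambda>k. ln_ext (norm (w k)) / ereal (real k)) \<longlonglongrightarrow> ereal L" and e: "e > 0"
  shows "\<forall>\<^sub>F n in sequentially. \<forall>k\<le>n. w k \<noteq> 0 \<longrightarrow>
    exp (- (e * n)) \<le> norm (w k) * exp (- L) ^ k \<and> norm (w k) * exp (- L) ^ k \<le> exp (e * n)"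
proof -
  obtain k1 where k1: "\<And>k. k \<ge> k1 \<Longrightarrow> exp (- (e * k)) \<le> norm (w k) * exp (- L) ^ k \<and> norm (w k) * exp (- L) ^ k \<le> exp (e * k)"
    using weights_eventually[OF w e] unfolding eventually_sequentially by blast
  have "\<forall>\<^sub>F n in sequentially. \<forall>k\<in>{..<k1}. w k \<noteq> 0 \<longrightarrow>
    exp (- (e * real n)) \<le> norm (w k) * exp (- L) ^ k \<and> norm (w k) * exp (- L) ^ k \<le> exp (e * real n)"
  proof (intro eventually_ball_finite ballI)
    fix k
    show "\<forall>\<^sub>F n in sequentially. w k \<noteq> 0 \<longrightarrow>
      exp (- (e * real n)) \<le> norm (w k) * exp (- L) ^ k \<and> norm (w k) * exp (- L) ^ k \<le> exp (e * real n)"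
    proof (cases "w k = 0")
      case False
      define v where "v = norm (w k) * exp (- L) ^ k"
      have v: "v > 0" using False by (simp add: v_def)
      have "filterlim (\<lambda>n. e * real n) at_top sequentially"
        using e by (intro filterlim_tendsto_pos_mult_at_top[OF tendsto_const] filterlim_real_sequentially)
      then have "\<forall>\<^sub>F n in sequentially. e * real n \<ge> \<bar>ln v\<bar>"
        by (simp add: filterlim_at_top)
      then show ?thesis
      proof eventually_elim
        case (elim n)
        then have "exp (- (e * real n)) \<le> exp (ln v)" "exp (ln v) \<le> exp (e * real n)"
          unfolding exp_le_cancel_iff by linarith+
        then show ?case using v unfolding v_def[symmetric] by simp
      qed
    qed simp
  qed simp
  then show ?thesis
  proof eventually_elim
    case (elim n)
    show ?case
    proof (intro allI impI)
      fix k assume k: "k \<le> n" "w k \<noteq> 0"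
      show "exp (- (e * real n)) \<le> norm (w k) * exp (- L) ^ k \<and> norm (w k) * exp (- L) ^ k \<le> exp (e * real n)"
      proof (cases "k < k1")
        case True
        then show ?thesis using elim k by auto
      next
        case False
        have "e * real k \<le> e * real n" using k e by simp
        then have "exp (- (e * real n)) \<le> exp (- (e * real k))" "exp (e * real k) \<le> exp (e * real n)" by simp_all
        moreover have "exp (- (e * k)) \<le> norm (w k) * exp (- L) ^ k \<and> norm (w k) * exp (- L) ^ k \<le> exp (e * k)"
          using k1[of k] False by simp
        ultimately show ?thesis by linarith
      qed
    qed
  qed
qed

text \<open>The deterministic content of the good event. The range in \<open>small\<close> starts at
  0 rather than at \<open>k0\<close>, since the lowest nonzero coefficient may lie below
  \<open>k0\<close>; beyond \<open>k0\<close> a nonzero \<open>\<xi> k \<omega>\<close> guarantees a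
  nonzero coefficient. The factor 3 counts the number of terms, \<open>\<xi> k\<close> and
  \<open>w k\<close> in the upper bound; the lower bounds spend two.\<close>

lemma weighted_poly_regular:
  fixes \<xi> :: "nat \<Rightarrow> 'a \<Rightarrow> complex" and w :: "nat \<Rightarrow> complex" and \<epsilon> r :: real and n k0 m :: nat and \<omega> :: 'a
  defines "p \<equiv> weighted_poly \<xi> w n \<omega>"
  assumes r: "r > 0" and eps: "\<epsilon> \<ge> 0"
    and wn: "\<And>k. k \<le> n \<Longrightarrow> w k \<noteq> 0 \<Longrightarrow> exp (- (\<epsilon> * n)) \<le> norm (w k) * r ^ k \<and> norm (w k) * r ^ k \<le> exp (\<epsilon> * n)"
    and wnz: "\<And>k. k \<ge> k0 \<Longrightarrow> w k \<noteq> 0"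
    and up: "\<And>k. k \<le> n \<Longrightarrow> norm (\<xi> k \<omega>) \<le> exp (\<epsilon> * n)"
    and n1: "real n + 1 \<le> exp (\<epsilon> * n)"
    and km: "real (k0 + m) \<le> \<epsilon> * n" "k0 + m \<le> n"
    and lo: "\<exists>k\<in>{k0..<k0+m}. \<xi> k \<omega> \<noteq> 0" and hi: "\<exists>k\<in>{n-m<..n}. \<xi> k \<omega> \<noteq> 0"
    and small: "\<And>k. k \<in> {..<k0+m} \<union> {n-m<..n} \<Longrightarrow> \<xi> k \<omega> \<noteq> 0 \<Longrightarrow> exp (- (\<epsilon> * n)) \<le> norm (\<xi> k \<omega>)"
  shows "p \<noteq> 0" "real (order 0 p) \<le> \<epsilon> * n" "real (n - degree p) \<le> \<epsilon> * n"
    "\<And>z. norm z = r \<Longrightarrow> norm (poly p z) \<le> exp (3 * \<epsilon> * n)"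
    "exp (- (3 * \<epsilon> * n)) \<le> norm (coeff p (order 0 p)) * r ^ order 0 p"
    "exp (- (3 * \<epsilon> * n)) \<le> norm (lead_coeff p) * r ^ degree p"
proof -
  obtain k where k: "k0 \<le> k" "k < k0 + m" "\<xi> k \<omega> \<noteq> 0" using lo by auto
  obtain l where l: "n - m < l" "l \<le> n" "\<xi> l \<omega> \<noteq> 0" using hi by auto
  have co: "coeff p k \<noteq> 0" "coeff p l \<noteq> 0"
    unfolding p_def coeff_weighted_poly using k l km(2) wnz[of k] wnz[of l] by auto
  then show p0: "p \<noteq> 0" by auto
  have ord: "order 0 p < k0 + m" using order_0_le_coeff[OF co(1)] k by simp
  then show "real (order 0 p) \<le> \<epsilon> * n" using km(1) by linarith
  have deg: "l \<le> degree p" using co(2) by (rule le_degree)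
  then show "real (n - degree p) \<le> \<epsilon> * n" using l km by linarith
  have degn: "degree p \<le> n" unfolding p_def by (rule degree_weighted_poly_le)
  have lower: "exp (- (3 * \<epsilon> * n)) \<le> norm (coeff p j) * r ^ j"
    if j: "j \<in> {..<k0+m} \<union> {n-m<..n}" "coeff p j \<noteq> 0" for j
  proof -
    have jn: "j \<le> n" "\<xi> j \<omega> \<noteq> 0" "w j \<noteq> 0"
      using j(2) unfolding p_def coeff_weighted_poly by (auto split: if_splits)
    have "exp (- (3 * \<epsilon> * n)) \<le> exp (- (\<epsilon> * n)) * exp (- (\<epsilon> * n))"
      using eps by (simp flip: exp_add)
    also have "\<dots> \<le> norm (\<xi> j \<omega>) * (norm (w j) * r ^ j)"
      using small[OF j(1) jn(2)] wn[OF jn(1,3)] by (intro mult_mono) auto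
    finally show ?thesis
      using jn(1) unfolding p_def coeff_weighted_poly by (simp add: norm_mult mult.assoc)
  qed
  show "exp (- (3 * \<epsilon> * n)) \<le> norm (coeff p (order 0 p)) * r ^ order 0 p"
    using ord coeff_order_0_nonzero[OF p0] by (intro lower) auto
  show "exp (- (3 * \<epsilon> * n)) \<le> norm (lead_coeff p) * r ^ degree p"
    using deg degn l p0 by (intro lower) auto
  fix z :: complex assume z: "norm z = r"
  have "norm (poly p z) \<le> (\<Sum>k=0..n. norm (\<xi> k \<omega> * w k * z ^ k))"
    unfolding p_def poly_weighted_poly by (rule norm_sum)
  also have "\<dots> \<le> (\<Sum>k=0..n. exp (\<epsilon> * n) * exp (\<epsilon> * n))"
  proof (rule sum_mono)
    fix k assume k: "k \<in> {0..n}"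
    have "norm (\<xi> k \<omega> * w k * z ^ k) = norm (\<xi> k \<omega>) * (norm (w k) * r ^ k)"
      by (simp add: norm_mult norm_power z mult.assoc)
    also have "\<dots> \<le> exp (\<epsilon> * n) * exp (\<epsilon> * n)"
    proof (cases "w k = 0")
      case False
      then show ?thesis using up[of k] wn[of k] k r by (intro mult_mono) auto
    qed simp
    finally show "norm (\<xi> k \<omega> * w k * z ^ k) \<le> exp (\<epsilon> * n) * exp (\<epsilon> * n)" .
  qed
  also have "\<dots> = (real n + 1) * (exp (\<epsilon> * n) * exp (\<epsilon> * n))" by (simp add: algebra_simps)
  also have "\<dots> \<le> exp (\<epsilon> * n) * (exp (\<epsilon> * n) * exp (\<epsilon> * n))"
    using n1 by (intro mult_right_mono) auto
  also have "\<dots> = exp (3 * \<epsilon> * n)" by (simp flip: exp_add)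
  finally show "norm (poly p z) \<le> exp (3 * \<epsilon> * n)" .
qed

section \<open>Probability estimates for the coefficients\<close>

context prob_space
begin

lemma prob_exists_le:
  assumes "finite J" "\<And>k. k \<in> J \<Longrightarrow> {\<omega> \<in> space M. P k \<omega>} \<in> events" "\<And>k. k \<in> J \<Longrightarrow> prob {\<omega> \<in> space M. P k \<omega>} = c"
  shows "prob {\<omega> \<in> space M. \<exists>k\<in>J. P k \<omega>} \<le> real (card J) * c"
proof -
  have "{\<omega> \<in> space M. \<exists>k\<in>J. P k \<omega>} = (\<Union>k\<in>J. {\<omega> \<in> space M. P k \<omega>})" by auto
  also have "prob \<dots> \<le> (\<Sum>k\<in>J. prob {\<omega> \<in> space M. P k \<omega>})"
    using assms(1,2) by (rule measure_UNION_le)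
  also have "\<dots> = real (card J) * c" using assms(3) by simp
  finally show ?thesis .
qed

lemma iid_measurable:
  assumes "iid M \<xi>"
  shows "\<xi> k \<in> borel_measurable M"
  using assms unfolding iid_def indep_vars_def by auto

lemma iid_prob_eq:
  assumes "iid M \<xi>" and P: "Measurable.pred borel P"
  shows "prob {\<omega> \<in> space M. P (\<xi> k \<omega>)} = prob {\<omega> \<in> space M. P (\<xi> 0 \<omega>)}"
proof -
  have A: "{z. P z} \<in> sets borel" using P by (simp add: pred_def)
  have "prob {\<omega> \<in> space M. P (\<xi> k \<omega>)} = measure (distr M borel (\<xi> k)) {z. P z}" for k
    using A iid_measurable[OF assms(1), of k] by (subst measure_distr) (auto intro!: arg_cong[where f = prob])
  then show ?thesis using assms(1) unfolding iid_def by metis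
qed

text \<open>Markov's inequality with a tail: \<open>n P(Y > n a) \<le> E[Y; Y > n a] / a\<close>.\<close>

lemma tail_times_n_tendsto_0:
  fixes Y :: "'a \<Rightarrow> real"
  assumes Y: "integrable M Y" and nonneg: "\<And>\<omega>. Y \<omega> \<ge> 0" and a: "a > 0"
  shows "(\<lambda>n. real n * prob {\<omega> \<in> space M. Y \<omega> > a * real n}) \<longlonglongrightarrow> 0"
proof -
  have [measurable]: "Y \<in> borel_measurable M" using Y by auto
  define f where "f n \<omega> = indicator {\<omega> \<in> space M. Y \<omega> > a * real n} \<omega> * Y \<omega>" for n \<omega>
  have f[measurable]: "f n \<in> borel_measurable M" for n unfolding f_def by measurable
  have "(\<lambda>n. integral\<^sup>L M (f n)) \<longlonglongrightarrow> integral\<^sup>L M (\<lambda>_. 0)"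
  proof (rule integral_dominated_convergence[where w = Y])
    show "AE \<omega> in M. (\<lambda>n. f n \<omega>) \<longlonglongrightarrow> 0"
    proof (intro AE_I2 tendsto_eventually)
      fix \<omega>
      have "filterlim (\<lambda>n. a * real n) at_top sequentially"
        using a by (intro filterlim_tendsto_pos_mult_at_top[OF tendsto_const] filterlim_real_sequentially)
      then have "\<forall>\<^sub>F n in sequentially. a * real n \<ge> Y \<omega>" by (simp add: filterlim_at_top)
      then show "\<forall>\<^sub>F n in sequentially. f n \<omega> = 0"
        by eventually_elim (auto simp: f_def indicator_def)
    qed
  qed (use Y nonneg in \<open>auto simp: f_def indicator_def\<close>)
  then have lim: "(\<lambda>n. integral\<^sup>L M (f n) / a) \<longlonglongrightarrow> 0"
    using tendsto_divide[OF _ tendsto_const, of _ 0 sequentially a] a by simp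
  show ?thesis
  proof (rule tendsto_sandwich[OF _ _ tendsto_const lim])
    show "\<forall>\<^sub>F n in sequentially. real n * prob {\<omega> \<in> space M. Y \<omega> > a * real n} \<le> integral\<^sup>L M (f n) / a"
    proof (intro always_eventually allI)
      fix n
      have "a * real n * prob {\<omega> \<in> space M. Y \<omega> > a * real n}
        = (\<integral>\<omega>. a * real n * indicator {\<omega> \<in> space M. Y \<omega> > a * real n} \<omega> \<partial>M)"
        by simp
      also have "\<dots> \<le> integral\<^sup>L M (f n)"
      proof (rule integral_mono)
        show "integrable M (\<lambda>\<omega>. a * real n * indicator {\<omega> \<in> space M. Y \<omega> > a * real n} \<omega>)"
          by (intro integrable_mult_right integrable_real_indicator) (auto simp: emeasure_eq_measure)
        show "integrable M (f n)"
          by (rule Bochner_Integration.integrable_bound[OF Y]) (use nonneg in \<open>auto simp: f_def indicator_def\<close>)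
      qed (auto simp: f_def indicator_def)
      finally show "real n * prob {\<omega> \<in> space M. Y \<omega> > a * real n} \<le> integral\<^sup>L M (f n) / a"
        using a by (simp add: field_simps)
    qed
  qed auto
qed

text \<open>The union bound over \<open>n + 1\<close> indices costs a factor of order
  \<open>n\<close>, which the tail of an integrable variable absorbs; the moment condition enters
  here.\<close>

lemma prob_some_large_tendsto_0:
  assumes iid: "iid M \<xi>" and int: "integrable M (\<lambda>\<omega>. ln (1 + norm (\<xi> 0 \<omega>)))" and e: "e > 0"
  shows "(\<lambda>n. prob {\<omega> \<in> space M. \<exists>k\<in>{..n}. norm (\<xi> k \<omega>) > exp (e * real n)}) \<longlonglongrightarrow> 0"
proof -
  have [measurable]: "\<xi> k \<in> borel_measurable M" for k by (rule iid_measurable[OF iid])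
  define Y where "Y = (\<lambda>\<omega>. ln (1 + norm (\<xi> 0 \<omega>)))"
  define T where "T n = prob {\<omega> \<in> space M. Y \<omega> > e * real n}" for n
  have lim: "(\<lambda>n. 2 * (real n * T n)) \<longlonglongrightarrow> 0"
    using tendsto_mult_right_zero[OF tail_times_n_tendsto_0[of Y e], of 2] int e unfolding T_def Y_def by auto
  have [measurable]: "Y \<in> borel_measurable M" unfolding Y_def by measurable
  show ?thesis
  proof (rule tendsto_sandwich[OF _ _ tendsto_const lim])
    show "\<forall>\<^sub>F n in sequentially. prob {\<omega> \<in> space M. \<exists>k\<in>{..n}. norm (\<xi> k \<omega>) > exp (e * real n)} \<le> 2 * (real n * T n)"
      using eventually_gt_at_top[of 0]
    proof eventually_elim
      case (elim n)
      have "prob {\<omega> \<in> space M. \<exists>k\<in>{..n}. norm (\<xi> k \<omega>) > exp (e * real n)}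
        \<le> real (card {..n}) * prob {\<omega> \<in> space M. norm (\<xi> 0 \<omega>) > exp (e * real n)}"
        by (intro prob_exists_le iid_prob_eq[OF iid, where P = "\<lambda>x. norm x > exp (e * real n)"]) auto
      also have "\<dots> \<le> real (card {..n}) * T n"
      proof -
        have "{\<omega> \<in> space M. norm (\<xi> 0 \<omega>) > exp (e * real n)} \<subseteq> {\<omega> \<in> space M. Y \<omega> > e * real n}"
        proof safe
          fix \<omega> assume "exp (e * real n) < norm (\<xi> 0 \<omega>)"
          then have "exp (e * real n) < 1 + norm (\<xi> 0 \<omega>)" by simp
          then show "e * real n < Y \<omega>" unfolding Y_def
            by (metis exp_gt_zero exp_ln_iff less_trans exp_less_cancel_iff)
        qed
        then show ?thesis unfolding T_def by (intro mult_left_mono finite_measure_mono) auto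
      qed
      also have "\<dots> \<le> 2 * real n * T n" using elim by (intro mult_right_mono) (auto simp: T_def)
      finally show ?case by simp
    qed
  qed auto
qed

text \<open>The events decrease to the empty set, so continuity from above applies;
  \<open>X \<omega> = 0\<close> is excluded because it may have positive probability. No rate
  results, so a union bound can afford a fixed number of indices.\<close>

lemma prob_small_nonzero_tendsto_0:
  assumes [measurable]: "X \<in> borel_measurable M" and e: "e > 0"
  shows "(\<lambda>n. prob {\<omega> \<in> space M. X \<omega> \<noteq> 0 \<and> norm (X \<omega> :: complex) < exp (- (e * real n))}) \<longlonglongrightarrow> 0"
proof -
  define A where "A n = {\<omega> \<in> space M. X \<omega> \<noteq> 0 \<and> norm (X \<omega>) < exp (- (e * real n))}" for n :: nat
  have "(\<lambda>n. prob (A n)) \<longlonglongrightarrow> prob (\<Inter>n. A n)"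
  proof (rule finite_Lim_measure_decseq)
    show "range A \<subseteq> events" unfolding A_def by auto
    show "decseq A"
    proof (rule decseq_SucI)
      fix n
      have "exp (- (e * real (Suc n))) \<le> exp (- (e * real n))" using e by simp
      then show "A (Suc n) \<subseteq> A n" unfolding A_def using less_le_trans by blast
    qed
  qed
  moreover have "(\<Inter>n. A n) = {}"
  proof (rule ccontr)
    assume "(\<Inter>n. A n) \<noteq> {}"
    then obtain \<omega> where \<omega>: "\<And>n. \<omega> \<in> A n" by blast
    have x: "norm (X \<omega>) > 0" using \<omega>[of 0] by (simp add: A_def)
    obtain n where n: "- ln (norm (X \<omega>)) < real n * e" using reals_Archimedean3[OF e] by blast
    have "exp (- (e * real n)) < exp (ln (norm (X \<omega>)))" unfolding exp_less_cancel_iff using n by (simp add: mult.commute)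
    also have "exp (ln (norm (X \<omega>))) = norm (X \<omega>)" using x by (rule exp_ln)
    finally show False using \<omega>[of n] by (simp add: A_def)
  qed
  ultimately show ?thesis unfolding A_def by simp
qed

text \<open>By independence it is exponentially unlikely in the length of a block that all its
  entries vanish; this serves for a block at either end of the index range.\<close>

lemma prob_all_zero:
  assumes iid: "iid M \<xi>" and J: "finite J" "J \<noteq> {}"
  shows "prob {\<omega> \<in> space M. \<forall>k\<in>J. \<xi> k \<omega> = 0} = prob {\<omega> \<in> space M. \<xi> 0 \<omega> = 0} ^ card J"
proof -
  have ind: "indep_vars (\<lambda>_. borel) \<xi> UNIV" using iid unfolding iid_def by blast
  have "{\<omega> \<in> space M. \<forall>k\<in>J. \<xi> k \<omega> = 0} = (\<Inter>k\<in>J. \<xi> k -` {0} \<inter> space M)" using J by auto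
  also have "prob \<dots> = (\<Prod>k\<in>J. prob (\<xi> k -` {0} \<inter> space M))"
    by (rule indep_varsD[OF ind]) (use J in auto)
  also have "\<dots> = (\<Prod>k\<in>J. prob {\<omega> \<in> space M. \<xi> 0 \<omega> = 0})"
  proof (rule prod.cong[OF refl])
    fix k
    have "\<xi> k -` {0} \<inter> space M = {\<omega> \<in> space M. \<xi> k \<omega> = 0}" by auto
    then show "prob (\<xi> k -` {0} \<inter> space M) = prob {\<omega> \<in> space M. \<xi> 0 \<omega> = 0}"
      using iid_prob_eq[OF iid, of "\<lambda>x. x = 0" k] by simp
  qed
  finally show ?thesis by simp
qed

lemma prob_zero_less_1:
  assumes "X \<in> borel_measurable M" and "nondegenerate M X"
  shows "prob {\<omega> \<in> space M. X \<omega> = (0::complex)} < 1"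
proof -
  have "prob {\<omega> \<in> space M. X \<omega> = 0} \<noteq> 1"
  proof
    assume "prob {\<omega> \<in> space M. X \<omega> = 0} = 1"
    from AE_prob_1[OF this] have "AE \<omega> in M. X \<omega> = 0" by auto
    then show False using assms(2) unfolding nondegenerate_def by blast
  qed
  then show ?thesis using prob_le_1 by (simp add: order_less_le)
qed

end


theorem theorem2p2:
  fixes M :: "'a measure"
    and \<xi> :: "nat \<Rightarrow> 'a \<Rightarrow> complex"
    and w :: "nat \<Rightarrow> complex"
    and L :: real
  assumes "prob_space M"
    and "iid M \<xi>"
    and "nondegenerate M (\<xi> 0)"
    and "integrable M (\<lambda>\<omega>. ln (1 + norm (\<xi> 0 \<omega>)))"
    and "(\<lambda>k. ln_ext (norm (w k)) / ereal (real k)) \<longlonglongrightarrow> ereal L"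
  shows "measures_converge_in_probability M
           (\<lambda>n \<omega>. scale_measure (ennreal (1 / real n)) (zero_measure (weighted_poly \<xi> w n \<omega>)))
           (\<lambda>\<omega>. uniform_circle (exp (- L)))"
proof -
  interpret prob_space M by fact
  note iid = assms(2)
  have \<xi>[measurable]: "\<xi> k \<in> borel_measurable M" for k by (rule iid_measurable[OF iid])
  define r where "r = exp (- L)"
  have r: "r > 0" by (simp add: r_def)
  define q where "q = prob {\<omega> \<in> space M. \<xi> 0 \<omega> = 0}"
  have q: "0 \<le> q" "q < 1"
    unfolding q_def using prob_zero_less_1[OF \<xi> assms(3)] by auto
  obtain k0 where k0: "\<And>k. k \<ge> k0 \<Longrightarrow> w k \<noteq> 0"
    using weights_eventually[OF assms(5), of 1] unfolding eventually_sequentially by auto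
  show ?thesis
    unfolding measures_converge_in_probability_def
  proof (intro allI impI)
    fix \<phi> :: "complex \<Rightarrow> real"
    assume cont: "continuous_on UNIV \<phi>" and supp: "compact (closure {z. \<phi> z \<noteq> 0})"
    define p where "p n \<omega> = weighted_poly \<xi> w n \<omega>" for n \<omega>
    define I where "I = (\<integral>z. \<phi> z \<partial>uniform_circle r)"
    define X where "X n \<omega> = (\<Sum>z\<in>#proots (p n \<omega>). \<phi> z) / real n" for n \<omega>
    \<comment> \<open>At \<open>n = 0\<close> both sides are 0, by the convention
      \<open>1 / 0 = 0\<close>.\<close>
    have int_eq: "integral\<^sup>L (scale_measure (ennreal (1 / real n)) (zero_measure (weighted_poly \<xi> w n \<omega>))) \<phi> = X n \<omega>" for n \<omega>
      using integral_scaled_zero_measure[of \<phi> "1 / real n" "p n \<omega>"] borel_measurable_continuous_onI[OF cont]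
      by (simp add: X_def p_def)
    have X[measurable]: "X n \<in> borel_measurable M" for n
    proof -
      have "(\<lambda>\<omega>. \<Sum>z\<in>#proots (p n \<omega>). \<phi> z) \<in> borel_measurable M"
        by (rule borel_measurable_sum_proots[of _ n])
          (auto simp: p_def degree_weighted_poly_le coeff_weighted_poly cont)
      then show ?thesis unfolding X_def by simp
    qed
    have lim: "(\<lambda>n. prob {\<omega> \<in> space M. \<bar>X n \<omega> - I\<bar> > d}) \<longlonglongrightarrow> 0" if d: "d > 0" for d
    proof -
      have "d / 2 > 0" using d by simp
      from root_average_close[OF cont supp r this] obtain C where C: "C \<ge> 0"
        and close: "\<And>(n::nat) (p::complex poly) (\<epsilon>::real). \<lbrakk>n > 0; p \<noteq> 0; degree p \<le> n; \<epsilon> \<ge> 0;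
          real (order 0 p) \<le> \<epsilon> * n; real (n - degree p) \<le> \<epsilon> * n;
          \<And>z. norm z = r \<Longrightarrow> norm (poly p z) \<le> exp (\<epsilon> * n);
          exp (- (\<epsilon> * n)) \<le> norm (coeff p (order 0 p)) * r ^ order 0 p;
          exp (- (\<epsilon> * n)) \<le> norm (lead_coeff p) * r ^ degree p\<rbrakk>
          \<Longrightarrow> \<bar>(\<Sum>z\<in>#proots p. \<phi> z) / real n - I\<bar> \<le> d / 2 + C * \<epsilon>"
        unfolding I_def by blast
      \<comment> \<open>The regularity estimates come with \<open>3 * \<epsilon>\<close>, so the
        total error is \<open>d / 2 + C * (3 * \<epsilon>) \<le> d\<close>; \<open>C + 1\<close>
        avoids a division by 0.\<close>
      define \<epsilon> where "\<epsilon> = d / (6 * (C + 1))"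
      have \<epsilon>: "\<epsilon> > 0" "C * (3 * \<epsilon>) \<le> d / 2"
        using C d by (auto simp: \<epsilon>_def field_simps)
      define U where "U n = prob {\<omega> \<in> space M. \<exists>k\<in>{..n}. norm (\<xi> k \<omega>) > exp (\<epsilon> * real n)}" for n
      define Q where "Q n = prob {\<omega> \<in> space M. \<xi> 0 \<omega> \<noteq> 0 \<and> norm (\<xi> 0 \<omega>) < exp (- (\<epsilon> * real n))}" for n :: nat
      have U: "U \<longlonglongrightarrow> 0"
        unfolding U_def by (rule prob_some_large_tendsto_0[OF iid assms(4) \<epsilon>(1)])
      have Q: "Q \<longlonglongrightarrow> 0"
        unfolding Q_def by (rule prob_small_nonzero_tendsto_0[OF \<xi> \<epsilon>(1)])
      \<comment> \<open>\<open>m\<close> is the length of the two end blocks and stays fixed while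
        \<open>n\<close> grows, hence the constant factor at \<open>Q n\<close>. Each
        \<open>q ^ m\<close> is the probability that one block has no nonzero entry.\<close>
      have bound: "\<forall>\<^sub>F n in sequentially. prob {\<omega> \<in> space M. \<bar>X n \<omega> - I\<bar> > d}
          \<le> U n + q ^ m + q ^ m + real (k0 + 2 * m) * Q n" if m: "m > 0" for m
      proof -
        have "filterlim (\<lambda>n. \<epsilon> * real n) at_top sequentially"
          using \<epsilon>(1) by (intro filterlim_tendsto_pos_mult_at_top[OF tendsto_const] filterlim_real_sequentially)
        then have ev1: "\<forall>\<^sub>F n in sequentially. real (k0 + m) \<le> \<epsilon> * real n"
          by (simp only: filterlim_at_top)
        have ev2: "\<forall>\<^sub>F n in sequentially. real n + 1 \<le> exp (\<epsilon> * real n)"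
          using \<epsilon>(1) by real_asymp
        show ?thesis
          using ev1 ev2 weights_uniform_eventually[OF assms(5) \<epsilon>(1)]
            eventually_ge_at_top[of "k0 + m"] eventually_gt_at_top[of 0]
        proof eventually_elim
          case (elim n)
          define J where "J = {..<k0+m} \<union> {n-m<..n}"
          define A1 where "A1 = {\<omega> \<in> space M. \<exists>k\<in>{..n}. norm (\<xi> k \<omega>) > exp (\<epsilon> * real n)}"
          define A2 where "A2 = {\<omega> \<in> space M. \<forall>k\<in>{k0..<k0+m}. \<xi> k \<omega> = 0}"
          define A3 where "A3 = {\<omega> \<in> space M. \<forall>k\<in>{n-m<..n}. \<xi> k \<omega> = 0}"
          define A4 where "A4 = {\<omega> \<in> space M. \<exists>k\<in>J. \<xi> k \<omega> \<noteq> 0 \<and> norm (\<xi> k \<omega>) < exp (- (\<epsilon> * real n))}"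
          have finJ: "finite J" by (simp add: J_def)
          have cardJ: "card J \<le> k0 + 2 * m"
            using card_Un_le[of "{..<k0+m}" "{n-m<..n}"] by (simp add: J_def)
          have ev: "A1 \<in> events" "A2 \<in> events" "A3 \<in> events" "A4 \<in> events"
            unfolding A1_def A2_def A3_def A4_def using finJ by measurable
          have "{\<omega> \<in> space M. \<bar>X n \<omega> - I\<bar> > d} \<subseteq> A1 \<union> A2 \<union> A3 \<union> A4"
          proof (rule subsetI, rule ccontr)
            fix \<omega> assume "\<omega> \<in> {\<omega> \<in> space M. \<bar>X n \<omega> - I\<bar> > d}" and "\<omega> \<notin> A1 \<union> A2 \<union> A3 \<union> A4"
            then have \<omega>: "\<omega> \<in> space M" "\<bar>X n \<omega> - I\<bar> > d" "\<omega> \<notin> A1" "\<omega> \<notin> A2" "\<omega> \<notin> A3" "\<omega> \<notin> A4"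
              by auto
            have up: "norm (\<xi> k \<omega>) \<le> exp (\<epsilon> * real n)" if "k \<le> n" for k
              using \<omega>(1,3) that unfolding A1_def by (auto simp: not_less)
            have lo: "\<exists>k\<in>{k0..<k0+m}. \<xi> k \<omega> \<noteq> 0" using \<omega>(1,4) unfolding A2_def by blast
            have hi: "\<exists>k\<in>{n-m<..n}. \<xi> k \<omega> \<noteq> 0" using \<omega>(1,5) unfolding A3_def by blast
            have small: "exp (- (\<epsilon> * real n)) \<le> norm (\<xi> k \<omega>)"
              if "k \<in> {..<k0+m} \<union> {n-m<..n}" "\<xi> k \<omega> \<noteq> 0" for k
              using \<omega>(1,6) that unfolding A4_def J_def by (auto simp: not_less)
            have wn: "exp (- (\<epsilon> * real n)) \<le> norm (w k) * r ^ k \<and> norm (w k) * r ^ k \<le> exp (\<epsilon> * real n)"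
              if "k \<le> n" "w k \<noteq> 0" for k using elim(3) that unfolding r_def by blast
            note reg = weighted_poly_regular[of r \<epsilon> n w k0 \<xi> \<omega> m, OF r less_imp_le[OF \<epsilon>(1)] wn k0 up elim(2,1,4) lo hi small,
                folded p_def]
            have "\<bar>X n \<omega> - I\<bar> \<le> d / 2 + C * (3 * \<epsilon>)"
              unfolding X_def
            proof (rule close[OF elim(5)])
              show "degree (p n \<omega>) \<le> n" unfolding p_def by (rule degree_weighted_poly_le)
              have le: "\<epsilon> * n \<le> 3 * \<epsilon> * n" using \<epsilon>(1) by simp
              show "real (order 0 (p n \<omega>)) \<le> 3 * \<epsilon> * n" "real (n - degree (p n \<omega>)) \<le> 3 * \<epsilon> * n"
                using reg(2,3) le by linarith+
            qed (use reg \<epsilon>(1) in auto)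
            then show False using \<omega>(2) \<epsilon>(2) by linarith
          qed
          then have "prob {\<omega> \<in> space M. \<bar>X n \<omega> - I\<bar> > d} \<le> prob (A1 \<union> A2 \<union> A3 \<union> A4)"
            using ev by (intro finite_measure_mono) auto
          also have "\<dots> \<le> prob A1 + prob A2 + prob A3 + prob A4"
            using ev measure_Un_le[of "A1 \<union> A2 \<union> A3" M A4] measure_Un_le[of "A1 \<union> A2" M A3] measure_Un_le[of A1 M A2]
            by simp
          also have "prob A1 = U n" by (simp add: A1_def U_def)
          also have "prob A2 = q ^ m"
            unfolding A2_def q_def using m by (subst prob_all_zero[OF iid]) auto
          also have "prob A3 = q ^ m"
            unfolding A3_def q_def using m elim(4) by (subst prob_all_zero[OF iid]) auto
          also have "prob A4 \<le> real (k0 + 2 * m) * Q n"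
          proof -
            have "prob A4 \<le> real (card J) * Q n"
              unfolding A4_def Q_def
              by (intro prob_exists_le finJ iid_prob_eq[OF iid, where P = "\<lambda>x. x \<noteq> 0 \<and> norm x < exp (- (\<epsilon> * real n))"]) auto
            also have "\<dots> \<le> real (k0 + 2 * m) * Q n"
              using cardJ by (intro mult_right_mono) (auto simp: Q_def)
            finally show ?thesis .
          qed
          finally show ?case by simp
        qed
      qed
      show ?thesis
      proof (rule tendstoI)
        fix \<eta> :: real assume \<eta>: "\<eta> > 0"
        \<comment> \<open>\<open>m\<close> is chosen before \<open>n\<close> tends to infinity;
          \<open>Suc m\<close> makes the blocks nonempty, as \<open>bound\<close> requires.\<close>
        obtain m where "q ^ m < \<eta> / 2" using real_arch_pow_inv[of "\<eta> / 2" q] \<eta> q by auto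
        then have m: "q ^ Suc m < \<eta> / 2"
          using q power_decreasing[of m "Suc m" q] by auto
        have "(\<lambda>n. U n + q ^ Suc m + q ^ Suc m + real (k0 + 2 * Suc m) * Q n)
            \<longlonglongrightarrow> 0 + q ^ Suc m + q ^ Suc m + real (k0 + 2 * Suc m) * 0"
          by (intro tendsto_intros U Q)
        then have "\<forall>\<^sub>F n in sequentially. U n + q ^ Suc m + q ^ Suc m + real (k0 + 2 * Suc m) * Q n < \<eta>"
          by (rule order_tendstoD(2)) (use m in simp)
        with bound[of "Suc m", simplified] show "\<forall>\<^sub>F n in sequentially. dist (prob {\<omega> \<in> space M. \<bar>X n \<omega> - I\<bar> > d}) 0 < \<eta>"
          by eventually_elim simp
      qed
    qed
    show "converges_in_probability M
        (\<lambda>n \<omega>. integral\<^sup>L (scale_measure (ennreal (1 / real n)) (zero_measure (weighted_poly \<xi> w n \<omega>))) \<phi>)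
        (\<lambda>\<omega>. integral\<^sup>L (uniform_circle (exp (- L))) \<phi>)"
      unfolding converges_in_probability_def int_eq r_def[symmetric] I_def[symmetric]
      using X lim by simp
  qed
qed

end
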